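(* Let $X,X_1,X_2,\ldots$ be i.i.d. random variables with $X\in DAN$, and for each $n\ge1$ let $(w_1^{(n)},\ldots,w_n^{(n)})$ have the multinomial distribution of size $m_n$ with probabilities $(\frac1n,\ldots,\frac1n)$, independent of the data (Efron's bootstrap). Let $Z$ be a standard normal random variable. If $n,m_n\to\infty$ so that $$\frac{m_n}{2n\log n}\to\infty,$$ then, for all $t\in\mathbb R$, $$P_{w|X}(T^{**}_{m_n}\le t)\to P(Z\le t)\ \text{ in probability-}P_X,$$ and, when $E_XX^2<\infty$, then for all $t\in\mathbb R$ $$P_{w|X}(T^{**}_{m_n}\le t)\to P(Z\le t)\ \text{ a.s.-}P_X.$$ Further, if instead $n,m_n\to\infty$ so that $m_n/n\to\infty$, then, when $E_XX^2<\infty$, for all $t\in\mathbb R$, $$P_{w|X}(T^{**}_{m_n}\le t)\to P(Z\le t)\ \text{ in probability-}P_X.$$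
   Context: $X\in DAN$ means that $X$ is in the domain of attraction of the normal law (possibly with infinite variance): there are constants $a_n\in\mathbb R$, $b_n>0$ with $b_n^{-1}(\sum_{i=1}^nX_i-a_n)\to N(0,1)$ in distribution. $w_i^{(n)}$ is the number of times index $i$ is chosen in $m_n$ draws with replacement from $1,\dots,n$; the bootstrap sample is $X_1^*,\ldots,X^*_{m_n}$. The data live on $(\Omega_X,\mathcal F_X,P_X)$, the weights on $(\Omega_w,\mathcal F_w,P_w)$, jointly on the product space; $P_{w|X}(\cdot)$ denotes conditional probability given $\sigma(X_1,\ldots,X_n)$. Put $\bar X^*_{m_n}=\frac1{m_n}\sum_{i=1}^nw_i^{(n)}X_i$, $S^{*2}_{m_n}=\frac1{m_n}\sum_{j=1}^{m_n}(X_j^*-\bar X^*_{m_n})^2=\frac1{m_n}\sum_{i=1}^nw_i^{(n)}(X_i-\bar X^*_{m_n})^2$, and $$T^{**}_{m_n}=\frac{\sum_{i=1}^n\big(\frac{w_i^{(n)}}{m_n}-\frac1n\big)X_i}{S^*_{m_n}/\sqrt{m_n}}.$$ *)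

theory Defs
  imports "HOL-Probability.Probability"
begin

definition DAN :: "'a measure \<Rightarrow> (nat \<Rightarrow> 'a \<Rightarrow> real) \<Rightarrow> bool" where
  "DAN P X \<longleftrightarrow> (\<exists>(a :: nat \<Rightarrow> real) (b :: nat \<Rightarrow> real). (\<forall>n. b n > 0) \<and>
     weak_conv_m (\<lambda>n. distr P borel (\<lambda>\<omega>. ((\<Sum>i=1..n. X i \<omega>) - a n) / b n))
       std_normal_distribution)"

definition conv_in_prob :: "'a measure \<Rightarrow> (nat \<Rightarrow> 'a \<Rightarrow> real) \<Rightarrow> real \<Rightarrow> bool" where
  "conv_in_prob P f c \<longleftrightarrow>
     (\<forall>\<epsilon>>0. (\<lambda>n. measure P {\<omega> \<in> space P. \<bar>f n \<omega> - c\<bar> > \<epsilon>}) \<longlonglongrightarrow> 0)"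

definition draw_counts :: "nat \<Rightarrow> (nat \<Rightarrow> 'b) \<Rightarrow> 'b \<Rightarrow> nat" where
  "draw_counts m d i = card {j \<in> {1..m}. d j = i}"

definition multinomial_pmf :: "nat \<Rightarrow> 'b pmf \<Rightarrow> ('b \<Rightarrow> nat) pmf" where
  "multinomial_pmf m p = map_pmf (draw_counts m) (Pi_pmf {1..m} undefined (\<lambda>_. p))"

text \<open>
  Row \<open>n\<close> of the array \<open>w\<close> consists of \<open>w n 1, \<dots>, w n n\<close> only; the padding by 0 turns it into
  a function on all indices. Nothing is assumed about the joint law of different rows.
\<close>

definition efron_weights :: "'b measure \<Rightarrow> (nat \<Rightarrow> nat) \<Rightarrow> (nat \<Rightarrow> nat \<Rightarrow> 'b \<Rightarrow> nat) \<Rightarrow> bool" where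
  "efron_weights Q m w \<longleftrightarrow> (\<forall>n\<ge>1.
     (\<forall>i\<in>{1..n}. w n i \<in> measurable Q (count_space UNIV)) \<and>
     distr Q (count_space UNIV) (\<lambda>\<omega> i. if i \<in> {1..n} then w n i \<omega> else 0)
       = measure_pmf (multinomial_pmf (m n) (pmf_of_set {1..n})))"

definition boot_mean :: "nat \<Rightarrow> nat \<Rightarrow> (nat \<Rightarrow> real) \<Rightarrow> (nat \<Rightarrow> nat) \<Rightarrow> real" where
  "boot_mean n m x v = (1 / real m) * (\<Sum>i=1..n. real (v i) * x i)"

definition boot_var :: "nat \<Rightarrow> nat \<Rightarrow> (nat \<Rightarrow> real) \<Rightarrow> (nat \<Rightarrow> nat) \<Rightarrow> real" where
  "boot_var n m x v = (1 / real m) * (\<Sum>i=1..n. real (v i) * (x i - boot_mean n m x v)\<^sup>2)"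

text \<open>When \<open>boot_var\<close> vanishes, the quotient is 0 by the usual convention for division by 0.\<close>

definition boot_T :: "nat \<Rightarrow> nat \<Rightarrow> (nat \<Rightarrow> real) \<Rightarrow> (nat \<Rightarrow> nat) \<Rightarrow> real" where
  "boot_T n m x v =
     (\<Sum>i=1..n. (real (v i) / real m - 1 / real n) * x i) / (sqrt (boot_var n m x v) / sqrt (real m))"

text \<open>In terms of the bootstrap sample \<open>x (d 1), \<dots>, x (d m)\<close>:\<close>

lemma sum_draws:
  fixes f :: "nat \<Rightarrow> real"
  assumes "d ` {1..m} \<subseteq> {1..n}"
  shows "(\<Sum>j=1..m. f (d j)) = (\<Sum>i=1..n. real (draw_counts m d i) * f i)"
proof -
  have "(\<Sum>i=1..n. real (draw_counts m d i) * f i)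
      = (\<Sum>i\<in>{1..n}. \<Sum>j\<in>{j\<in>{1..m}. d j = i}. f (d j))"
    by (simp add: draw_counts_def)
  also have "\<dots> = (\<Sum>j=1..m. f (d j))"
    using assms by (intro sum.group) auto
  finally show ?thesis ..
qed

lemma boot_var_eq_sample_var:
  assumes "d ` {1..m} \<subseteq> {1..n}"
  shows "boot_var n m x (draw_counts m d)
       = (1 / real m) * (\<Sum>j=1..m. (x (d j) - (1 / real m) * (\<Sum>k=1..m. x (d k)))\<^sup>2)"
  using sum_draws[OF assms, of x]
    sum_draws[OF assms, of "\<lambda>i. (x i - boot_mean n m x (draw_counts m d))\<^sup>2"]
  by (simp add: boot_var_def boot_mean_def)

text \<open>The \<open>\<sigma>\<close>-algebra generated by \<open>X 1, \<dots>, X n\<close>, on the product of the data space \<open>P\<close> and the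
  weight space \<open>Q\<close>.\<close>

definition data_algebra ::
    "'a measure \<Rightarrow> 'b measure \<Rightarrow> (nat \<Rightarrow> 'a \<Rightarrow> real) \<Rightarrow> nat \<Rightarrow> ('a \<times> 'b) measure" where
  "data_algebra P Q X n =
     vimage_algebra (space (P \<Otimes>\<^sub>M Q)) (\<lambda>(x, y). \<lambda>i\<in>{1..n}. X i x) (\<Pi>\<^sub>M i\<in>{1..n}. borel)"

definition joint_cond_prob ::
    "'a measure \<Rightarrow> 'b measure \<Rightarrow> (nat \<Rightarrow> 'a \<Rightarrow> real) \<Rightarrow> nat \<Rightarrow> ('a \<times> 'b) set \<Rightarrow> 'a \<times> 'b \<Rightarrow> real" where
  "joint_cond_prob P Q X n A = real_cond_exp (P \<Otimes>\<^sub>M Q) (data_algebra P Q X n) (indicator A)"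

text \<open>Being measurable with respect to \<open>data_algebra\<close>, \<open>joint_cond_prob\<close> does not depend on the
  second coordinate (see \<open>joint_cond_prob_eq\<close>), so it is a random variable on the data space; the point
  chosen below is immaterial.\<close>

definition data_cond_prob ::
    "'a measure \<Rightarrow> 'b measure \<Rightarrow> (nat \<Rightarrow> 'a \<Rightarrow> real) \<Rightarrow> nat \<Rightarrow> ('a \<times> 'b) set \<Rightarrow> 'a \<Rightarrow> real" where
  "data_cond_prob P Q X n A x = joint_cond_prob P Q X n A (x, SOME y. y \<in> space Q)"

lemma joint_cond_prob_eq:
  assumes x: "x \<in> space P" and y: "y \<in> space Q"
  shows "joint_cond_prob P Q X n A (x, y) = data_cond_prob P Q X n A x"
proof -
  define y' where "y' = (SOME y. y \<in> space Q)"
  have y': "y' \<in> space Q"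
    unfolding y'_def using y by (rule someI)
  let ?f = "joint_cond_prob P Q X n A" and ?F = "data_algebra P Q X n"
  let ?B = "?f -` {?f (x, y)} \<inter> space ?F"
  have F: "space ?F = space (P \<Otimes>\<^sub>M Q)"
    by (simp add: data_algebra_def)
  have "?f \<in> borel_measurable ?F"
    unfolding joint_cond_prob_def by simp
  then have "?B \<in> sets ?F"
    by (rule measurable_sets) simp
  also have "sets ?F =
      {(\<lambda>(x, y). \<lambda>i\<in>{1..n}. X i x) -` C \<inter> space (P \<Otimes>\<^sub>M Q) |C. C \<in> sets (\<Pi>\<^sub>M i\<in>{1..n}. borel)}"
    unfolding data_algebra_def by (rule sets_vimage_algebra2) (auto simp: space_PiM)
  finally obtain C where
    "?B = (\<lambda>(x, y). \<lambda>i\<in>{1..n}. X i x) -` C \<inter> space (P \<Otimes>\<^sub>M Q)"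
    by blast
  then have "(x, y) \<in> ?B \<longleftrightarrow> (x, y') \<in> ?B"
    using x y y' by (simp add: space_pair_measure)
  then show ?thesis
    using x y y' F by (simp add: space_pair_measure data_cond_prob_def y'_def)
qed

definition T_event ::
    "'a measure \<Rightarrow> 'b measure \<Rightarrow> (nat \<Rightarrow> 'a \<Rightarrow> real) \<Rightarrow> (nat \<Rightarrow> nat) \<Rightarrow> (nat \<Rightarrow> nat \<Rightarrow> 'b \<Rightarrow> nat) \<Rightarrow>
     nat \<Rightarrow> real \<Rightarrow> ('a \<times> 'b) set" where
  "T_event P Q X m w n t =
     {(x, y) \<in> space (P \<Otimes>\<^sub>M Q). boot_T n (m n) (\<lambda>i. X i x) (\<lambda>i. w n i y) \<le> t}"

end

theory Submission
  imports Defs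
begin

text \<open>
  Freeze the data \<open>x 1, \<dots>, x n\<close> and replace them by their z-scores \<open>y i\<close>, that is, subtract
  the mean and divide by the standard deviation of the uniform distribution on the \<open>n\<close> data points.
  The statistic \<open>boot_T\<close> does not change, and it becomes the studentized mean of \<open>m\<close> independent
  draws from a distribution with mean 0 and variance 1 (\<open>boot_T_draw_counts\<close>). The point is that
  these draws are automatically bounded: the squares of the z-scores add up to \<open>n\<close>, hence
  \<open>\<bar>y i\<bar> \<le> sqrt n\<close>, whatever the data are, as long as they are not all equal. So
  \<open>m n / n \<rightarrow> \<infinity>\<close> says that the summands \<open>y i / sqrt m\<close> are uniformly small, which is
  Lindeberg's condition in its strongest form. The array central limit theorem
  (\<open>array_clt_bounded\<close>, by characteristic functions), a law of large numbers for the sample variance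
  (\<open>sample_sd_deviation\<close>, by Chebyshev's inequality) and Slutsky's theorem (\<open>slutsky_quotient\<close>) give
  the limit for every deterministic array of data whose rows are eventually nonconstant
  (\<open>multinomial_boot_clt\<close>).

  Probability on the data space enters in two places. The weights being independent of the data, the
  conditional probability is, almost surely, the multinomial probability with the data held fixed
  (\<open>data_cond_prob_T_event\<close>, an application of Fubini's theorem). And i.i.d. data in the domain of
  attraction of the normal law are almost surely not all equal: the normalized sums of constants have
  distribution functions with values 0 and 1 only, which cannot converge to a continuous
  distribution function (\<open>DAN_nondegenerate\<close>, \<open>AE_iid_nonconstant\<close>).

  Together these give convergence almost surely whenever \<open>m n / n \<rightarrow> \<infinity>\<close>
  (\<open>AE_conditional_boot_clt\<close>). All three assertions follow, because
  \<open>m n / (2 n ln n) \<rightarrow> \<infinity>\<close> implies \<open>m n / n \<rightarrow> \<infinity>\<close> and almost sure convergence implies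
  convergence in probability.
\<close>

section \<open>Means of i.i.d. samples: second moments and characteristic functions\<close>

text \<open>
  The law of the vector of draws. The default value \<open>undefined\<close> is the one in \<open>multinomial_pmf\<close>, so
  that \<open>multinomial_pmf m p\<close> is literally an image of \<open>iid_sample m p\<close>.
\<close>

abbreviation iid_sample :: "nat \<Rightarrow> 'b pmf \<Rightarrow> (nat \<Rightarrow> 'b) pmf" where
  "iid_sample m p \<equiv> Pi_pmf {1..m} undefined (\<lambda>_. p)"

lemma distr_coordinate_iid_sample:
  assumes "j \<in> {1..m}"
  shows "distr (iid_sample m p) borel (\<lambda>d. h (d j)) = distr p borel (h :: 'b \<Rightarrow> real)"
proof -
  have "map_pmf (\<lambda>d. d j) (iid_sample m p) = p"
    using assms by (simp add: Pi_pmf_component)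
  then have "distr p borel h = distr (map_pmf (\<lambda>d. d j) (iid_sample m p)) borel h"
    by simp
  also have "\<dots> = distr (iid_sample m p) borel (\<lambda>d. h (d j))"
    by (simp add: map_pmf_rep_eq distr_distr comp_def)
  finally show ?thesis ..
qed

lemma expectation_coordinate_iid_sample:
  assumes "j \<in> {1..m}"
  shows "measure_pmf.expectation (iid_sample m p) (\<lambda>d. h (d j))
       = measure_pmf.expectation p (h :: 'b \<Rightarrow> real)"
proof -
  have "map_pmf (\<lambda>d. d j) (iid_sample m p) = p"
    using assms by (simp add: Pi_pmf_component)
  then show ?thesis
    by (metis (no_types, lifting) Bochner_Integration.integral_cong integral_map_pmf)
qed

lemma indep_vars_iid_sample:
  "prob_space.indep_vars (iid_sample m p) (\<lambda>_. borel) (\<lambda>j d. h (d j) :: real) {1..m}"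
  by (rule prob_space.indep_vars_compose2[OF measure_pmf.prob_space_axioms indep_vars_Pi_pmf]) auto

lemma set_iid_sample:
  "d \<in> set_pmf (iid_sample m p) \<Longrightarrow> j \<in> {1..m} \<Longrightarrow> d j \<in> set_pmf p"
  by (auto simp: set_Pi_pmf PiE_dflt_def)

text \<open>
  The mixed terms in the expanded square vanish, since by independence each of them is a product of
  two expectations 0.
\<close>

lemma (in prob_space) second_moment_sum_indep:
  fixes Y :: "'i \<Rightarrow> 'a \<Rightarrow> real"
  assumes "finite I" and ind: "indep_vars (\<lambda>_. borel) Y I"
    and sq: "\<And>i. i \<in> I \<Longrightarrow> integrable M (\<lambda>x. (Y i x)\<^sup>2)"
    and mean: "\<And>i. i \<in> I \<Longrightarrow> expectation (Y i) = 0"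
  shows "expectation (\<lambda>x. (\<Sum>i\<in>I. Y i x)\<^sup>2) = (\<Sum>i\<in>I. expectation (\<lambda>x. (Y i x)\<^sup>2))"
proof -
  have rv: "random_variable borel (Y i)" if "i \<in> I" for i
    using ind that by (simp add: indep_vars_def)
  have int: "integrable M (Y i)" if "i \<in> I" for i
    using rv sq that by (auto intro: square_integrable_imp_integrable)
  have pair: "integrable M (\<lambda>x. Y i x * Y k x) \<and>
      expectation (\<lambda>x. Y i x * Y k x) = (if i = k then expectation (\<lambda>x. (Y i x)\<^sup>2) else 0)"
    if "i \<in> I" "k \<in> I" for i k
  proof (cases "i = k")
    case True
    then show ?thesis using sq that by (simp add: power2_eq_square)
  next
    case False
    have "indep_vars (\<lambda>_. borel) Y {i, k}"
      using ind that by (auto intro: indep_vars_subset)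
    then show ?thesis
      using indep_vars_integrable[of "{i, k}" Y] indep_vars_lebesgue_integral[of "{i, k}" Y]
        False int mean that
      by auto
  qed
  have "expectation (\<lambda>x. (\<Sum>i\<in>I. Y i x)\<^sup>2) = expectation (\<lambda>x. \<Sum>i\<in>I. \<Sum>k\<in>I. Y i x * Y k x)"
    by (simp add: power2_eq_square sum_product)
  also have "\<dots> = (\<Sum>i\<in>I. \<Sum>k\<in>I. expectation (\<lambda>x. Y i x * Y k x))"
    using pair by (simp add: Bochner_Integration.integral_sum Bochner_Integration.integrable_sum)
  also have "\<dots> = (\<Sum>i\<in>I. \<Sum>k\<in>I. if i = k then expectation (\<lambda>x. (Y i x)\<^sup>2) else 0)"
    using pair by (intro sum.cong) auto
  also have "\<dots> = (\<Sum>i\<in>I. expectation (\<lambda>x. (Y i x)\<^sup>2))"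
    using \<open>finite I\<close> by simp
  finally show ?thesis .
qed

lemma integrable_pmf_bounded:
  fixes h :: "'b \<Rightarrow> real"
  assumes "\<And>z. z \<in> set_pmf p \<Longrightarrow> \<bar>h z\<bar> \<le> B"
  shows "integrable (measure_pmf p) h"
  using assms by (intro measure_pmf.integrable_const_bound[where B = B] AE_pmfI) auto

text \<open>
  Chebyshev's inequality, with the second moment of the sum from \<open>second_moment_sum_indep\<close>;
  boundedness provides the integrability.
\<close>

lemma sample_mean_deviation:
  fixes g :: "'b \<Rightarrow> real"
  assumes m: "0 < m" and a: "0 < a"
    and bdd: "\<And>z. z \<in> set_pmf p \<Longrightarrow> \<bar>g z\<bar> \<le> B"
    and mean: "measure_pmf.expectation p g = 0"
  shows "measure_pmf.prob (iid_sample m p) {d. \<bar>(1 / real m) * (\<Sum>j=1..m. g (d j))\<bar> \<ge> a}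
       \<le> measure_pmf.expectation p (\<lambda>z. (g z)\<^sup>2) / (real m * a\<^sup>2)"
proof -
  let ?D = "iid_sample m p" and ?S = "\<lambda>d. \<Sum>j=1..m. g (d j)"
  have bdd': "\<bar>g (d j)\<bar> \<le> B" if "d \<in> set_pmf ?D" "j \<in> {1..m}" for d j
    using that set_iid_sample bdd by metis
  have sqb: "\<bar>(g (d j))\<^sup>2\<bar> \<le> B\<^sup>2" if "d \<in> set_pmf ?D" "j \<in> {1..m}" for d j
    using bdd'[OF that] by (simp add: abs_le_square_iff power2_le_iff_abs_le order_trans[OF abs_ge_zero])
  have Sb: "\<bar>(?S d)\<^sup>2\<bar> \<le> (real m * B)\<^sup>2" if "d \<in> set_pmf ?D" for d
  proof -
    have "\<bar>?S d\<bar> \<le> (\<Sum>j=1..m. \<bar>g (d j)\<bar>)" by (rule sum_abs)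
    also have "\<dots> \<le> (\<Sum>j=1..m. B)" by (intro sum_mono bdd' that)
    finally have "\<bar>?S d\<bar> \<le> real m * B" by simp
    then show ?thesis
      by (metis abs_ge_zero abs_power2 order_trans power2_abs power_mono)
  qed
  have Sint: "integrable ?D (\<lambda>d. (?S d)\<^sup>2)"
    by (rule integrable_pmf_bounded[OF Sb])
  have "{d. \<bar>(1 / real m) * ?S d\<bar> \<ge> a} = {d \<in> space (measure_pmf ?D). \<bar>?S d\<bar> \<ge> real m * a}"
    using m by (auto simp: abs_mult field_simps)
  then have "measure_pmf.prob ?D {d. \<bar>(1 / real m) * ?S d\<bar> \<ge> a}
      \<le> measure_pmf.expectation ?D (\<lambda>d. (?S d)\<^sup>2) / (real m * a)\<^sup>2"
    using measure_pmf.second_moment_method[of ?S ?D "real m * a"] m a Sint by simp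
  also have "measure_pmf.expectation ?D (\<lambda>d. (?S d)\<^sup>2)
      = (\<Sum>j=1..m. measure_pmf.expectation ?D (\<lambda>d. (g (d j))\<^sup>2))"
    using expectation_coordinate_iid_sample[of _ m p g] mean
    by (intro measure_pmf.second_moment_sum_indep indep_vars_iid_sample
        integrable_pmf_bounded[where B = "B\<^sup>2"] sqb) auto
  also have "\<dots> = (\<Sum>j=1..m. measure_pmf.expectation p (\<lambda>z. (g z)\<^sup>2))"
    by (intro sum.cong refl expectation_coordinate_iid_sample[where h = "\<lambda>z. (g z)\<^sup>2"])
  also have "\<dots> / (real m * a)\<^sup>2 = measure_pmf.expectation p (\<lambda>z. (g z)\<^sup>2) / (real m * a\<^sup>2)"
    using m by (simp add: power2_eq_square)
  finally show ?thesis .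
qed

text \<open>
  The characteristic function of the normalized sum is an \<open>m\<close>-th power. By Taylor expansion, each
  factor differs from \<open>1 - t\<^sup>2 / (2 m)\<close> by at most a constant times
  \<open>\<bar>t\<bar>\<^sup>3 E \<bar>f\<bar>\<^sup>3 / m\<^bsup>3/2\<^esup>\<close>, and \<open>E \<bar>f\<bar>\<^sup>3 \<le> c E f\<^sup>2 = c\<close>. For two numbers in
  the unit disc, the \<open>m\<close>-th powers differ by at most \<open>m\<close> times the difference of the numbers; the
  condition \<open>t\<^sup>2 / 4 \<le> m\<close> puts \<open>1 - t\<^sup>2 / (2 m)\<close> into the unit disc.
\<close>

lemma char_normalized_sum_iid_sample:
  fixes f :: "'b \<Rightarrow> real"
  assumes m: "0 < m" "t\<^sup>2 / 4 \<le> real m"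
    and bdd: "\<And>z. z \<in> set_pmf p \<Longrightarrow> \<bar>f z\<bar> \<le> c"
    and mean: "measure_pmf.expectation p f = 0"
    and var: "measure_pmf.expectation p (\<lambda>z. (f z)\<^sup>2) = 1"
  shows "cmod (char (distr (iid_sample m p) borel (\<lambda>d. (\<Sum>j=1..m. f (d j)) / sqrt (real m))) t
           - (1 + (- (t\<^sup>2) / 2) / real m) ^ m) \<le> \<bar>t\<bar> ^ 3 * c / (6 * sqrt (real m))"
proof -
  let ?D = "iid_sample m p" and ?s = "t / sqrt (real m)"
  define \<mu> where "\<mu> = distr (measure_pmf p) borel f"
  interpret \<mu>: real_distribution \<mu>
    unfolding \<mu>_def by (rule prob_space.real_distribution_distr[OF measure_pmf.prob_space_axioms]) simp
  have sqb: "\<bar>(f z)\<^sup>2\<bar> \<le> c\<^sup>2" if "z \<in> set_pmf p" for z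
    using bdd[OF that] by (metis abs_ge_zero abs_power2 power2_abs power_mono)
  have f1: "integrable p f" by (rule integrable_pmf_bounded[OF bdd])
  have f2: "integrable p (\<lambda>z. (f z)\<^sup>2)" by (rule integrable_pmf_bounded[OF sqb])
  have char1: "char (distr ?D borel (\<lambda>d. f (d j) / sqrt (real m))) t = char \<mu> ?s"
    if "j \<in> {1..m}" for j
  proof -
    have "distr ?D borel (\<lambda>d. f (d j) / sqrt (real m)) = distr p borel (\<lambda>z. f z / sqrt (real m))"
      using distr_coordinate_iid_sample[OF that, of p "\<lambda>z. f z / sqrt (real m)"] .
    then show ?thesis
      by (simp add: char_def \<mu>_def integral_distr)
  qed
  have "char (distr ?D borel (\<lambda>d. (\<Sum>j=1..m. f (d j)) / sqrt (real m))) t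
      = char (distr ?D borel (\<lambda>d. \<Sum>j\<in>{1..m}. f (d j) / sqrt (real m))) t"
    by (simp add: sum_divide_distrib)
  also have "\<dots> = (\<Prod>j\<in>{1..m}. char (distr ?D borel (\<lambda>d. f (d j) / sqrt (real m))) t)"
    using indep_vars_iid_sample[of m p "\<lambda>z. f z / sqrt (real m)"]
    by (rule prob_space.char_distr_sum[OF measure_pmf.prob_space_axioms])
  also have "\<dots> = char \<mu> ?s ^ m"
    using char1 by (subst prod.cong[OF refl char1]) simp_all
  finally have eq: "char (distr ?D borel (\<lambda>d. (\<Sum>j=1..m. f (d j)) / sqrt (real m))) t
      = char \<mu> ?s ^ m" .

  have "\<mu>.expectation (\<lambda>x. x) = 0" "\<mu>.expectation (\<lambda>x. x\<^sup>2) = 1"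
    "integrable \<mu> (\<lambda>x. x)" "integrable \<mu> (\<lambda>x. x\<^sup>2)"
    using mean var f1 f2 by (simp_all add: \<mu>_def integral_distr integrable_distr_eq)
  then have near: "cmod (char \<mu> ?s - complex_of_real (1 - ?s\<^sup>2 * 1 / 2))
      \<le> ?s\<^sup>2 / 6 * \<mu>.expectation (\<lambda>x. min (6 * x\<^sup>2) (\<bar>?s\<bar> * \<bar>x\<bar> ^ 3))"
    using \<mu>.char_approx3[of 1 ?s] by simp
  have "\<mu>.expectation (\<lambda>x. min (6 * x\<^sup>2) (\<bar>?s\<bar> * \<bar>x\<bar> ^ 3))
      = measure_pmf.expectation p (\<lambda>z. min (6 * (f z)\<^sup>2) (\<bar>?s\<bar> * \<bar>f z\<bar> ^ 3))"
    by (simp add: \<mu>_def integral_distr)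
  also have "\<dots> \<le> measure_pmf.expectation p (\<lambda>z. \<bar>?s\<bar> * c * (f z)\<^sup>2)"
  proof (intro integral_mono_AE AE_pmfI)
    show "integrable p (\<lambda>z. min (6 * (f z)\<^sup>2) (\<bar>?s\<bar> * \<bar>f z\<bar> ^ 3))"
      by (rule Bochner_Integration.integrable_bound[OF integrable_mult_right[OF f2, of 6]]) auto
    show "integrable p (\<lambda>z. \<bar>?s\<bar> * c * (f z)\<^sup>2)" using f2 by simp
    fix z assume "z \<in> set_pmf p"
    then have "\<bar>f z\<bar> * (f z)\<^sup>2 \<le> c * (f z)\<^sup>2" by (intro mult_right_mono bdd) auto
    then have "\<bar>f z\<bar> ^ 3 \<le> c * (f z)\<^sup>2" by (simp add: power3_eq_cube power2_eq_square)
    then have "\<bar>?s\<bar> * \<bar>f z\<bar> ^ 3 \<le> \<bar>?s\<bar> * (c * (f z)\<^sup>2)" by (rule mult_left_mono) simp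
    then show "min (6 * (f z)\<^sup>2) (\<bar>?s\<bar> * \<bar>f z\<bar> ^ 3) \<le> \<bar>?s\<bar> * c * (f z)\<^sup>2"
      by (simp add: mult.assoc min.coboundedI2)
  qed
  also have "\<dots> = \<bar>?s\<bar> * c" using var by simp
  finally have "?s\<^sup>2 / 6 * \<mu>.expectation (\<lambda>x. min (6 * x\<^sup>2) (\<bar>?s\<bar> * \<bar>x\<bar> ^ 3))
      \<le> ?s\<^sup>2 / 6 * (\<bar>?s\<bar> * c)"
    by (rule mult_left_mono) simp
  moreover have s: "1 - ?s\<^sup>2 * 1 / 2 = 1 + (- (t\<^sup>2) / 2) / real m"
    by (simp add: power_divide)
  ultimately have one: "cmod (char \<mu> ?s - complex_of_real (1 + (- (t\<^sup>2) / 2) / real m))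
      \<le> ?s\<^sup>2 / 6 * (\<bar>?s\<bar> * c)"
    using near[unfolded s] by linarith

  have "cmod (char \<mu> ?s ^ m - (complex_of_real (1 + (- (t\<^sup>2) / 2) / real m)) ^ m)
      \<le> m * cmod (char \<mu> ?s - (complex_of_real (1 + (- (t\<^sup>2) / 2) / real m)))"
    using m
    by (auto intro!: norm_power_diff \<mu>.cmod_char_le_1 abs_leI
        simp del: of_real_diff simp: of_real_diff[symmetric] divide_le_eq)
  also have "\<dots> \<le> m * (?s\<^sup>2 / 6 * (\<bar>?s\<bar> * c))"
    using one by (rule mult_left_mono) simp
  also have "\<dots> = \<bar>t\<bar> ^ 3 * c / (6 * sqrt (real m))"
    using m by (simp add: power_divide abs_divide power3_eq_cube power2_eq_square field_simps)
  finally show ?thesis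
    unfolding eq by simp
qed

text \<open>
  Central limit theorem for rows of i.i.d. variables whose bound \<open>c n\<close> is of smaller order than
  \<open>sqrt (m n)\<close>. The laws \<open>p n\<close> may vary freely with the row, and the error bound of
  \<open>char_normalized_sum_iid_sample\<close> depends on them through \<open>c n\<close> only.
\<close>

theorem array_clt_bounded:
  fixes p :: "nat \<Rightarrow> 'b pmf" and f :: "nat \<Rightarrow> 'b \<Rightarrow> real"
  assumes m: "filterlim m at_top sequentially"
    and bdd: "\<forall>\<^sub>F n in sequentially. \<forall>z\<in>set_pmf (p n). \<bar>f n z\<bar> \<le> c n"
    and mean: "\<forall>\<^sub>F n in sequentially. measure_pmf.expectation (p n) (f n) = 0"
    and var: "\<forall>\<^sub>F n in sequentially. measure_pmf.expectation (p n) (\<lambda>z. (f n z)\<^sup>2) = 1"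
    and small: "(\<lambda>n. c n / sqrt (real (m n))) \<longlonglongrightarrow> 0"
  shows "weak_conv_m
    (\<lambda>n. distr (iid_sample (m n) (p n)) borel (\<lambda>d. (\<Sum>j=1..m n. f n (d j)) / sqrt (real (m n))))
    std_normal_distribution"
proof (rule levy_continuity)
  fix t :: real
  let ?\<phi> = "\<lambda>n. char (distr (iid_sample (m n) (p n)) borel
      (\<lambda>d. (\<Sum>j=1..m n. f n (d j)) / sqrt (real (m n)))) t"
  let ?e = "\<lambda>k :: nat. complex_of_real ((1 + (- (t\<^sup>2) / 2) / real k) ^ k)"
  have "\<forall>\<^sub>F n in sequentially. max 1 (nat \<lceil>t\<^sup>2 / 4\<rceil>) \<le> m n"
    using m unfolding filterlim_at_top by blast
  then have err: "\<forall>\<^sub>F n in sequentially. norm (?\<phi> n - ?e (m n))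
      \<le> \<bar>t\<bar> ^ 3 / 6 * (c n / sqrt (real (m n)))"
    using bdd mean var
  proof eventually_elim
    case (elim n)
    then have "0 < m n" "t\<^sup>2 / 4 \<le> real (m n)" by linarith+
    from char_normalized_sum_iid_sample[OF this, of "p n" "f n" "c n"] elim show ?case
      by simp
  qed
  have lim0: "(\<lambda>n. \<bar>t\<bar> ^ 3 / 6 * (c n / sqrt (real (m n)))) \<longlonglongrightarrow> 0"
    using tendsto_mult_left[OF small, of "\<bar>t\<bar> ^ 3 / 6"] by simp
  have "?e \<longlonglongrightarrow> complex_of_real (exp (- (t\<^sup>2) / 2))"
    by (rule isCont_tendsto_compose[OF _ tendsto_exp_limit_sequentially]) auto
  then have "(\<lambda>n. ?e (m n)) \<longlonglongrightarrow> complex_of_real (exp (- (t\<^sup>2) / 2))"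
    by (rule filterlim_compose[OF _ m])
  then have "?\<phi> \<longlonglongrightarrow> complex_of_real (exp (- (t\<^sup>2) / 2))"
    by (rule Lim_transform) (rule Lim_null_comparison[OF err lim0])
  then show "?\<phi> \<longlonglongrightarrow> char std_normal_distribution t"
    by (simp add: char_std_normal_distribution)
qed (auto intro!: real_dist_normal_dist
    prob_space.real_distribution_distr[OF measure_pmf.prob_space_axioms])

section \<open>The studentized mean of a triangular array\<close>

lemma isCont_cdf_std_normal: "isCont (cdf std_normal_distribution) x"
proof -
  interpret real_distribution std_normal_distribution by (rule real_dist_normal_dist)
  have "emeasure std_normal_distribution {x} = 0"
    by (simp add: emeasure_density nn_integral_null_set null_sets_def)
  then show ?thesis
    by (simp add: isCont_cdf measure_def)
qed

text \<open>
  On the event that \<open>S n\<close> is within \<open>\<delta>\<close> of 1, the inequality \<open>N n / S n \<le> t\<close> is squeezed between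
  \<open>N n \<le> t - \<bar>t\<bar> \<delta>\<close> and \<open>N n \<le> t + \<bar>t\<bar> \<delta>\<close>; the limiting probabilities of these two
  are close to \<open>cdf L t\<close> because \<open>cdf L\<close> is continuous.
\<close>

lemma slutsky_quotient:
  fixes M :: "nat \<Rightarrow> 'c measure" and N S :: "nat \<Rightarrow> 'c \<Rightarrow> real"
  assumes M: "\<And>n. prob_space (M n)"
    and meas [measurable]: "\<And>n. N n \<in> borel_measurable (M n)" "\<And>n. S n \<in> borel_measurable (M n)"
    and N: "weak_conv_m (\<lambda>n. distr (M n) borel (N n)) L"
    and cont: "\<And>x. isCont (cdf L) x"
    and S: "\<And>\<epsilon>. 0 < \<epsilon> \<Longrightarrow> (\<lambda>n. measure (M n) {\<omega> \<in> space (M n). \<bar>S n \<omega> - 1\<bar> > \<epsilon>}) \<longlonglongrightarrow> 0"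
  shows "(\<lambda>n. measure (M n) {\<omega> \<in> space (M n). N n \<omega> / S n \<omega> \<le> t}) \<longlonglongrightarrow> cdf L t"
proof (rule LIMSEQ_I)
  fix e :: real assume "0 < e"
  then have e3: "0 < e / 3" by simp
  have lim: "(\<lambda>n. measure (M n) {\<omega> \<in> space (M n). N n \<omega> \<le> u}) \<longlonglongrightarrow> cdf L u" for u
  proof -
    have "cdf (distr (M n) borel (N n)) u = measure (M n) {\<omega> \<in> space (M n). N n \<omega> \<le> u}" for n
      by (auto simp: cdf_def measure_distr intro!: arg_cong[where f = "measure (M n)"])
    moreover have "(\<lambda>n. cdf (distr (M n) borel (N n)) u) \<longlonglongrightarrow> cdf L u"
      using N cont unfolding weak_conv_m_def weak_conv_def by blast
    ultimately show ?thesis by simp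
  qed
  obtain h where h: "0 < h" "\<And>x. \<bar>x - t\<bar> < h \<Longrightarrow> \<bar>cdf L x - cdf L t\<bar> < e / 3"
    using cont[of t] \<open>0 < e\<close> unfolding continuous_at_eps_delta dist_real_def
    by (metis divide_pos_pos zero_less_numeral)
  \<comment> \<open>The first bound keeps the denominator positive, the second makes \<open>\<bar>t\<bar> \<delta> < h\<close>.\<close>
  define \<delta> where "\<delta> = min (1 / 2) (h / (2 * (\<bar>t\<bar> + 1)))"
  have \<delta>: "0 < \<delta>" "\<delta> \<le> 1 / 2"
    using h(1) by (simp add: \<delta>_def, unfold \<delta>_def, intro min.cobounded1)
  have "\<bar>t\<bar> * \<delta> \<le> (\<bar>t\<bar> + 1) * (h / (2 * (\<bar>t\<bar> + 1)))"
    using \<delta> by (intro mult_mono) (auto simp: \<delta>_def)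
  also have "\<dots> < h" using h(1) by (simp add: field_simps add_pos_nonneg)
  finally have th: "\<bar>t\<bar> * \<delta> < h" .
  define t_up t_low where "t_up = t + \<bar>t\<bar> * \<delta>" and "t_low = t - \<bar>t\<bar> * \<delta>"
  have u: "\<bar>cdf L t_up - cdf L t\<bar> < e / 3" and l: "\<bar>cdf L t_low - cdf L t\<bar> < e / 3"
    using h(2)[of t_up] h(2)[of t_low] th \<delta>(1) by (simp_all add: abs_mult t_up_def t_low_def)
  have "\<forall>\<^sub>F n in sequentially.
      \<bar>measure (M n) {\<omega> \<in> space (M n). N n \<omega> / S n \<omega> \<le> t} - cdf L t\<bar> < e"
    using tendstoD[OF lim[of t_up] e3] tendstoD[OF lim[of t_low] e3] tendstoD[OF S[OF \<delta>(1)] e3]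
  proof eventually_elim
    case (elim n)
    interpret prob_space "M n" by (rule M)
    let ?T = "{\<omega> \<in> space (M n). N n \<omega> / S n \<omega> \<le> t}"
      and ?B = "{\<omega> \<in> space (M n). \<delta> < \<bar>S n \<omega> - 1\<bar>}"
    have good: "(N n \<omega> / S n \<omega> \<le> t \<longleftrightarrow> N n \<omega> \<le> t * S n \<omega>) \<and> t_low \<le> t * S n \<omega> \<and> t * S n \<omega> \<le> t_up" if "\<not> \<delta> < \<bar>S n \<omega> - 1\<bar>" for \<omega>
    proof -
      have "\<bar>t * (S n \<omega> - 1)\<bar> \<le> \<bar>t\<bar> * \<delta>"
        using that by (simp add: abs_mult mult_left_mono)
      then show ?thesis
        using that \<delta> by (auto simp: t_up_def t_low_def pos_divide_le_eq algebra_simps abs_le_iff)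
    qed
    have "prob ?T \<le> prob ({\<omega> \<in> space (M n). N n \<omega> \<le> t_up} \<union> ?B)"
      using good by (intro finite_measure_mono) (auto intro: order_trans)
    also have "\<dots> \<le> prob {\<omega> \<in> space (M n). N n \<omega> \<le> t_up} + prob ?B"
      by (intro measure_Un_le) auto
    finally have up: "prob ?T \<le> prob {\<omega> \<in> space (M n). N n \<omega> \<le> t_up} + prob ?B" .
    have "prob {\<omega> \<in> space (M n). N n \<omega> \<le> t_low} \<le> prob (?T \<union> ?B)"
      using good by (intro finite_measure_mono) (auto intro: order_trans)
    also have "\<dots> \<le> prob ?T + prob ?B"
      by (intro measure_Un_le) auto
    finally have lo: "prob {\<omega> \<in> space (M n). N n \<omega> \<le> t_low} \<le> prob ?T + prob ?B" .
    show ?case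
      using up lo u l elim unfolding dist_real_def abs_less_iff by linarith
  qed
  then show "\<exists>n0. \<forall>n\<ge>n0.
      norm (measure (M n) {\<omega> \<in> space (M n). N n \<omega> / S n \<omega> \<le> t} - cdf L t) < e"
    by (simp add: eventually_sequentially)
qed

lemma abs_sqrt_minus_one_le:
  assumes "0 \<le> v"
  shows "\<bar>sqrt v - 1\<bar> \<le> \<bar>v - 1\<bar>"
proof -
  have "\<bar>v - 1\<bar> = \<bar>sqrt v - 1\<bar> * (sqrt v + 1)"
    using assms abs_mult[of "sqrt v - 1" "sqrt v + 1"] by (simp add: algebra_simps)
  also have "\<dots> \<ge> \<bar>sqrt v - 1\<bar> * 1"
    using assms by (intro mult_left_mono) auto
  finally show ?thesis by simp
qed

text \<open>
  The sample variance is \<open>1 + A - B\<^sup>2\<close>, where \<open>A\<close> is the sample mean of \<open>f\<^sup>2 - 1\<close> and \<open>B\<close> that of \<open>f\<close>. Both have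
  mean 0 and are controlled by Chebyshev's inequality; the variance of \<open>f\<^sup>2 - 1\<close> is at most
  \<open>E f\<^sup>4 \<le> c\<^sup>2 E f\<^sup>2 = c\<^sup>2\<close>.
\<close>

lemma sample_sd_deviation:
  fixes f :: "'b \<Rightarrow> real"
  assumes m: "0 < m" and \<delta>: "0 < \<delta>" "\<delta> < 1"
    and bdd: "\<And>z. z \<in> set_pmf p \<Longrightarrow> \<bar>f z\<bar> \<le> c"
    and mean: "measure_pmf.expectation p f = 0"
    and var: "measure_pmf.expectation p (\<lambda>z. (f z)\<^sup>2) = 1"
  shows "measure_pmf.prob (iid_sample m p)
      {d. \<bar>sqrt ((1 / real m) * (\<Sum>j=1..m. (f (d j))\<^sup>2) - ((1 / real m) * (\<Sum>j=1..m. f (d j)))\<^sup>2) - 1\<bar> > \<delta>}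
    \<le> (4 / \<delta>\<^sup>2) * (c / sqrt (real m))\<^sup>2 + (2 / \<delta>) / real m"
    (is "measure_pmf.prob ?D {d. \<bar>sqrt (?V d) - 1\<bar> > \<delta>} \<le> _")
proof -
  let ?A = "\<lambda>d. (1 / real m) * (\<Sum>j=1..m. (f (d j))\<^sup>2 - 1)" and ?B = "\<lambda>d. (1 / real m) * (\<Sum>j=1..m. f (d j))"
  have sqb: "(f z)\<^sup>2 \<le> c\<^sup>2" if "z \<in> set_pmf p" for z
    using bdd[OF that] by (metis abs_ge_zero power2_abs power_mono)
  have f2: "integrable p (\<lambda>z. (f z)\<^sup>2)"
    using sqb by (intro integrable_pmf_bounded[where B = "c\<^sup>2"]) simp
  have gb: "\<bar>(f z)\<^sup>2 - 1\<bar> \<le> c\<^sup>2 + 1" if "z \<in> set_pmf p" for z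
    using sqb[OF that] zero_le_power2[of "f z"] zero_le_power2[of c] by linarith
  have A0: "measure_pmf.expectation p (\<lambda>z. (f z)\<^sup>2 - 1) = 0"
    using f2 var by simp
  have "measure_pmf.expectation p (\<lambda>z. ((f z)\<^sup>2 - 1)\<^sup>2)
      \<le> measure_pmf.expectation p (\<lambda>z. (c\<^sup>2 - 2) * (f z)\<^sup>2 + 1)"
  proof (intro integral_mono_AE AE_pmfI)
    show "integrable p (\<lambda>z. ((f z)\<^sup>2 - 1)\<^sup>2)"
      using gb by (intro integrable_pmf_bounded[where B = "(c\<^sup>2 + 1)\<^sup>2"])
        (metis abs_ge_zero abs_power2 power2_abs power_mono)
    show "integrable p (\<lambda>z. (c\<^sup>2 - 2) * (f z)\<^sup>2 + 1)" using f2 by simp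
    fix z assume "z \<in> set_pmf p"
    then have "(f z)\<^sup>2 * (f z)\<^sup>2 \<le> c\<^sup>2 * (f z)\<^sup>2" by (intro mult_right_mono sqb) auto
    then show "((f z)\<^sup>2 - 1)\<^sup>2 \<le> (c\<^sup>2 - 2) * (f z)\<^sup>2 + 1"
      by (simp add: power2_eq_square algebra_simps)
  qed
  also have "\<dots> \<le> c\<^sup>2" using f2 var by simp
  finally have g2: "measure_pmf.expectation p (\<lambda>z. ((f z)\<^sup>2 - 1)\<^sup>2) \<le> c\<^sup>2" .

  have sub: "{d. \<bar>sqrt (?V d) - 1\<bar> > \<delta>} \<subseteq> {d. \<bar>?A d\<bar> \<ge> \<delta> / 2} \<union> {d. \<bar>?B d\<bar> \<ge> sqrt (\<delta> / 2)}"
  proof (intro subsetI, rule ccontr)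
    fix d
    assume d: "d \<in> {d. \<bar>sqrt (?V d) - 1\<bar> > \<delta>}"
      and no: "d \<notin> {d. \<bar>?A d\<bar> \<ge> \<delta> / 2} \<union> {d. \<bar>?B d\<bar> \<ge> sqrt (\<delta> / 2)}"
    have V: "?V d = 1 + ?A d - (?B d)\<^sup>2"
      using m by (simp add: sum_subtractf field_simps)
    have "\<bar>?B d\<bar> < sqrt (\<delta> / 2)" using no by simp
    then have "\<bar>?B d\<bar>\<^sup>2 < (sqrt (\<delta> / 2))\<^sup>2" by (intro power_strict_mono) auto
    then have B: "(?B d)\<^sup>2 < \<delta> / 2" unfolding power2_abs using \<delta> by simp
    have "\<bar>?A d\<bar> < \<delta> / 2" using no by simp
    \<comment> \<open>Since \<open>\<delta> < 1\<close>, the sample variance is nonnegative, so its square root is at least as close to 1 as it is itself.\<close>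
    then have dev: "\<bar>?V d - 1\<bar> < \<delta>" and "0 \<le> ?V d"
      unfolding V using B \<delta> zero_le_power2[of "?B d"] by linarith+
    then show False
      using abs_sqrt_minus_one_le[of "?V d"] d by simp
  qed
  have "measure_pmf.prob ?D {d. \<bar>sqrt (?V d) - 1\<bar> > \<delta>}
      \<le> measure_pmf.prob ?D {d. \<bar>?A d\<bar> \<ge> \<delta> / 2} + measure_pmf.prob ?D {d. \<bar>?B d\<bar> \<ge> sqrt (\<delta> / 2)}"
    by (rule order_trans[OF measure_pmf.finite_measure_mono[OF sub]
        measure_Un_le]) auto
  also have "measure_pmf.prob ?D {d. \<bar>?A d\<bar> \<ge> \<delta> / 2} \<le> c\<^sup>2 / (real m * (\<delta> / 2)\<^sup>2)"
    using sample_mean_deviation[OF m, of "\<delta> / 2" p "\<lambda>z. (f z)\<^sup>2 - 1" "c\<^sup>2 + 1"] \<delta> gb A0 g2 m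
    by (smt (verit, best) divide_right_mono half_gt_zero mult_nonneg_nonneg of_nat_0_le_iff zero_le_power2)
  also have "measure_pmf.prob ?D {d. \<bar>?B d\<bar> \<ge> sqrt (\<delta> / 2)} \<le> 1 / (real m * (sqrt (\<delta> / 2))\<^sup>2)"
    using sample_mean_deviation[OF m, of "sqrt (\<delta> / 2)" p f c] \<delta> bdd mean var by simp
  also have "c\<^sup>2 / (real m * (\<delta> / 2)\<^sup>2) = (4 / \<delta>\<^sup>2) * (c / sqrt (real m))\<^sup>2"
    using m \<delta> by (simp add: power_divide field_simps)
  also have "1 / (real m * (sqrt (\<delta> / 2))\<^sup>2) = (2 / \<delta>) / real m"
    using m \<delta> by (simp add: field_simps)
  finally show ?thesis by simp
qed

theorem studentized_array_clt:
  fixes p :: "nat \<Rightarrow> 'b pmf" and f :: "nat \<Rightarrow> 'b \<Rightarrow> real"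
  assumes m: "filterlim m at_top sequentially"
    and bdd: "\<forall>\<^sub>F n in sequentially. \<forall>z\<in>set_pmf (p n). \<bar>f n z\<bar> \<le> c n"
    and mean: "\<forall>\<^sub>F n in sequentially. measure_pmf.expectation (p n) (f n) = 0"
    and var: "\<forall>\<^sub>F n in sequentially. measure_pmf.expectation (p n) (\<lambda>z. (f n z)\<^sup>2) = 1"
    and small: "(\<lambda>n. c n / sqrt (real (m n))) \<longlonglongrightarrow> 0"
  shows "(\<lambda>n. measure_pmf.prob (iid_sample (m n) (p n))
      {d. (\<Sum>j=1..m n. f n (d j)) / sqrt (real (m n)) /
          sqrt ((1 / real (m n)) * (\<Sum>j=1..m n. (f n (d j))\<^sup>2)
                - ((1 / real (m n)) * (\<Sum>j=1..m n. f n (d j)))\<^sup>2) \<le> t})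
    \<longlonglongrightarrow> cdf std_normal_distribution t"
proof -
  let ?D = "\<lambda>n. iid_sample (m n) (p n)"
  let ?N = "\<lambda>n d. (\<Sum>j=1..m n. f n (d j)) / sqrt (real (m n))"
  let ?S = "\<lambda>n d. sqrt ((1 / real (m n)) * (\<Sum>j=1..m n. (f n (d j))\<^sup>2)
                - ((1 / real (m n)) * (\<Sum>j=1..m n. f n (d j)))\<^sup>2)"
  have m_pos: "\<forall>\<^sub>F n in sequentially. 0 < m n"
    using m by (rule eventually_compose_filterlim[OF eventually_gt_at_top])
  have consistent: "(\<lambda>n. measure_pmf.prob (?D n) {d. \<epsilon> < \<bar>?S n d - 1\<bar>}) \<longlonglongrightarrow> 0"
    if "0 < \<epsilon>" for \<epsilon>
  proof -
    define \<delta> where "\<delta> = min \<epsilon> (1 / 2)"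
    have \<delta>: "0 < \<delta>" "\<delta> < 1" "\<delta> \<le> \<epsilon>" using that by (auto simp: \<delta>_def)
    have "\<forall>\<^sub>F n in sequentially. measure_pmf.prob (?D n) {d. \<epsilon> < \<bar>?S n d - 1\<bar>}
        \<le> (4 / \<delta>\<^sup>2) * (c n / sqrt (real (m n)))\<^sup>2 + (2 / \<delta>) / real (m n)"
      using m_pos bdd mean var
    proof eventually_elim
      case (elim n)
      have "measure_pmf.prob (?D n) {d. \<epsilon> < \<bar>?S n d - 1\<bar>}
          \<le> measure_pmf.prob (?D n) {d. \<delta> < \<bar>?S n d - 1\<bar>}"
        using \<delta>(3) by (intro measure_pmf.finite_measure_mono) auto
      also have "\<dots> \<le> (4 / \<delta>\<^sup>2) * (c n / sqrt (real (m n)))\<^sup>2 + (2 / \<delta>) / real (m n)"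
        using elim by (intro sample_sd_deviation \<delta>) auto
      finally show ?case .
    qed
    moreover have "(\<lambda>n. (4 / \<delta>\<^sup>2) * (c n / sqrt (real (m n)))\<^sup>2 + (2 / \<delta>) / real (m n)) \<longlonglongrightarrow> 0"
    proof -
      have "filterlim (\<lambda>n. real (m n)) at_top sequentially"
        by (rule filterlim_compose[OF filterlim_real_sequentially m])
      then have "(\<lambda>n. (2 / \<delta>) / real (m n)) \<longlonglongrightarrow> 0"
        by (rule real_tendsto_divide_at_top[OF tendsto_const])
      then show ?thesis
        using tendsto_add[OF tendsto_mult[OF tendsto_const tendsto_power[OF small]], of _ 0 "4 / \<delta>\<^sup>2" 2]
        by simp
    qed
    ultimately show ?thesis
      by (rule tendsto_sandwich[OF always_eventually[OF allI[OF measure_nonneg]] _ tendsto_const])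
  qed
  have "(\<lambda>n. measure_pmf.prob (?D n) {d \<in> space (measure_pmf (?D n)). ?N n d / ?S n d \<le> t})
      \<longlonglongrightarrow> cdf std_normal_distribution t"
  proof (rule slutsky_quotient[OF _ _ _ array_clt_bounded[OF m bdd mean var small]])
    show "(\<lambda>n. measure_pmf.prob (?D n) {d \<in> space (measure_pmf (?D n)). \<epsilon> < \<bar>?S n d - 1\<bar>}) \<longlonglongrightarrow> 0"
      if "0 < \<epsilon>" for \<epsilon>
      using consistent[OF that] unfolding space_measure_pmf by simp
  qed (rule measure_pmf.prob_space_axioms isCont_cdf_std_normal measurable_pmf_measure1 | simp)+
  then show ?thesis unfolding space_measure_pmf by simp
qed

section \<open>The bootstrap statistic of a fixed data set\<close>

definition data_mean :: "nat \<Rightarrow> (nat \<Rightarrow> real) \<Rightarrow> real" where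
  "data_mean n x = (\<Sum>i=1..n. x i) / real n"

definition data_sd :: "nat \<Rightarrow> (nat \<Rightarrow> real) \<Rightarrow> real" where
  "data_sd n x = sqrt ((\<Sum>i=1..n. (x i - data_mean n x)\<^sup>2) / real n)"

definition zscore :: "nat \<Rightarrow> (nat \<Rightarrow> real) \<Rightarrow> nat \<Rightarrow> real" where
  "zscore n x i = (x i - data_mean n x) / data_sd n x"

lemma data_sd_pos:
  assumes "i \<in> {1..n}" "k \<in> {1..n}" "x i \<noteq> x k"
  shows "0 < data_sd n x"
proof -
  have "x i \<noteq> data_mean n x \<or> x k \<noteq> data_mean n x" using assms by auto
  then have "0 < (\<Sum>i=1..n. (x i - data_mean n x)\<^sup>2)"
    using assms(1,2) by (elim disjE; intro sum_pos2) auto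
  then show ?thesis using assms(1) by (simp add: data_sd_def)
qed

lemma sum_zscore: "(\<Sum>i=1..n. zscore n x i) = 0"
proof (cases "n = 0")
  case False
  then have "(\<Sum>i=1..n. x i - data_mean n x) = 0"
    by (simp add: sum_subtractf data_mean_def)
  then show ?thesis
    by (simp add: zscore_def flip: sum_divide_distrib)
qed simp

lemma sum_zscore_square:
  assumes "0 < data_sd n x"
  shows "(\<Sum>i=1..n. (zscore n x i)\<^sup>2) = real n"
proof -
  have n: "n \<noteq> 0" using assms by (cases "n = 0") (auto simp: data_sd_def)
  have "(data_sd n x)\<^sup>2 = (\<Sum>i=1..n. (x i - data_mean n x)\<^sup>2) / real n"
    by (simp add: data_sd_def sum_nonneg)
  then have "(\<Sum>i=1..n. (x i - data_mean n x)\<^sup>2) = real n * (data_sd n x)\<^sup>2"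
    using n by simp
  then show ?thesis
    using assms by (simp add: zscore_def power_divide flip: sum_divide_distrib)
qed

text \<open>
  One term of the sum of squares is at most the whole sum, which is \<open>n\<close>. This bound is uniform in the
  data; it is what turns \<open>m n / n \<rightarrow> \<infinity>\<close> into Lindeberg's condition.
\<close>

lemma abs_zscore_le:
  assumes "0 < data_sd n x" "i \<in> {1..n}"
  shows "\<bar>zscore n x i\<bar> \<le> sqrt (real n)"
proof -
  have "(zscore n x i)\<^sup>2 \<le> (\<Sum>i=1..n. (zscore n x i)\<^sup>2)"
    using assms(2) by (intro member_le_sum) auto
  then show ?thesis
    using sum_zscore_square[OF assms(1)] by (metis real_sqrt_abs real_sqrt_le_mono)
qed

text \<open>
  The statistic is invariant under translation and positive scaling of the data, because the bootstrap
  counts add up to \<open>m\<close>. The right-hand side agrees with the left one also when the bootstrap variance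
  vanishes, both sides then being quotients by 0.
\<close>

lemma boot_T_draw_counts:
  assumes d: "d ` {1..m} \<subseteq> {1..n}" and m: "0 < m" and n: "0 < n" and sd: "0 < data_sd n x"
  shows "boot_T n m x (draw_counts m d)
    = (\<Sum>j=1..m. zscore n x (d j)) / sqrt (real m) /
      sqrt ((1 / real m) * (\<Sum>j=1..m. (zscore n x (d j))\<^sup>2)
            - ((1 / real m) * (\<Sum>j=1..m. zscore n x (d j)))\<^sup>2)"
proof -
  let ?a = "data_mean n x" and ?s = "data_sd n x" and ?y = "zscore n x"
  let ?S = "\<Sum>j=1..m. ?y (d j)" and ?Q = "\<Sum>j=1..m. (?y (d j))\<^sup>2"
  have x: "x i = ?a + ?s * ?y i" for i using sd by (simp add: zscore_def)
  have xsum: "(\<Sum>j=1..m. x (d j)) = real m * ?a + ?s * ?S"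
    by (subst x) (simp add: sum.distrib flip: sum_distrib_left)
  have "(\<Sum>i=1..n. (real (draw_counts m d i) / real m - 1 / real n) * x i)
      = (\<Sum>i=1..n. real (draw_counts m d i) * x i) / real m - ?a"
    by (simp add: left_diff_distrib sum_subtractf data_mean_def sum_divide_distrib)
  also have "\<dots> = ?s * (?S / real m)"
    unfolding sum_draws[OF d, of x, symmetric] xsum using m by (simp add: add_divide_distrib)
  finally have num: "(\<Sum>i=1..n. (real (draw_counts m d i) / real m - 1 / real n) * x i)
      = ?s * (?S / real m)" .
  have "(x (d j) - (1 / real m) * (\<Sum>k=1..m. x (d k)))\<^sup>2
      = ?s\<^sup>2 * ((?y (d j))\<^sup>2 - 2 * (?S / real m) * ?y (d j) + (?S / real m)\<^sup>2)" for j
  proof -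
    have "x (d j) - (1 / real m) * (\<Sum>k=1..m. x (d k)) = ?s * (?y (d j) - ?S / real m)"
      unfolding xsum using x[of "d j"] m by (simp add: field_simps)
    then show ?thesis by (simp only: power_mult_distrib) (simp add: power2_diff mult_ac)
  qed
  note square = this
  have "boot_var n m x (draw_counts m d)
      = (1 / real m) * (\<Sum>j=1..m. ?s\<^sup>2 * ((?y (d j))\<^sup>2 - 2 * (?S / real m) * ?y (d j) + (?S / real m)\<^sup>2))"
    by (simp only: boot_var_eq_sample_var[OF d] square)
  also have "(\<Sum>j=1..m. ?s\<^sup>2 * ((?y (d j))\<^sup>2 - 2 * (?S / real m) * ?y (d j) + (?S / real m)\<^sup>2))
      = ?s\<^sup>2 * (?Q - 2 * (?S / real m) * ?S + real m * (?S / real m)\<^sup>2)"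
    by (simp only: sum.distrib sum_subtractf sum_distrib_left[symmetric] sum_constant) simp
  also have "(1 / real m) * \<dots> = ?s\<^sup>2 * ((1 / real m) * ?Q - ((1 / real m) * ?S)\<^sup>2)"
    using m by (simp add: field_simps power2_eq_square)
  finally have var: "boot_var n m x (draw_counts m d)
      = ?s\<^sup>2 * ((1 / real m) * ?Q - ((1 / real m) * ?S)\<^sup>2)" .
  have rescale: "?s * (u / real m) / (?s * v / sqrt (real m)) = u / sqrt (real m) / v" for u v
    using sd m by (cases "v = 0") (auto simp: field_simps)
  show ?thesis
    unfolding boot_T_def num var real_sqrt_mult
    using rescale sd by simp
qed

text \<open>
  The conditional limit theorem with the data held fixed. The data may change arbitrarily from row to row:
  the bound on the z-scores makes the convergence uniform over all nonconstant data.
\<close>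

theorem multinomial_boot_clt:
  fixes x :: "nat \<Rightarrow> nat \<Rightarrow> real"
  assumes m: "filterlim (\<lambda>n. real (m n) / real n) at_top sequentially"
    and nonconst: "\<forall>\<^sub>F n in sequentially. \<exists>i\<in>{1..n}. x n i \<noteq> x n 1"
  shows "(\<lambda>n. measure_pmf.prob (multinomial_pmf (m n) (pmf_of_set {1..n}))
      {v. boot_T n (m n) (x n) v \<le> t}) \<longlonglongrightarrow> cdf std_normal_distribution t"
proof -
  let ?p = "\<lambda>n. pmf_of_set {1..n::nat}" and ?y = "\<lambda>n. zscore n (x n)"
  have m_top: "filterlim m at_top sequentially"
  proof -
    have "\<forall>\<^sub>F n in sequentially. real (m n) / real n \<le> real (m n)"
      using eventually_gt_at_top[of "0::nat"]
      by eventually_elim (simp add: divide_le_eq mult_le_cancel_left1)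
    then have "filterlim (\<lambda>n. real (m n)) at_top sequentially"
      by (rule filterlim_at_top_mono[OF m])
    then show ?thesis by (simp add: filterlim_sequentially_iff_filterlim_real)
  qed
  have sd: "\<forall>\<^sub>F n in sequentially. 0 < n \<and> 0 < data_sd n (x n)"
    using nonconst
  proof eventually_elim
    case (elim n)
    then obtain i where "i \<in> {1..n}" "x n i \<noteq> x n 1" by blast
    then show ?case using data_sd_pos[of i n 1 "x n"] by auto
  qed
  have small: "(\<lambda>n. sqrt (real n) / sqrt (real (m n))) \<longlonglongrightarrow> 0"
    using tendsto_real_sqrt[OF tendsto_inverse_0_at_top[OF m]]
    by (simp add: real_sqrt_divide inverse_eq_divide)
  have "(\<lambda>n. measure_pmf.prob (iid_sample (m n) (?p n))
      {d. (\<Sum>j=1..m n. ?y n (d j)) / sqrt (real (m n)) /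
          sqrt ((1 / real (m n)) * (\<Sum>j=1..m n. (?y n (d j))\<^sup>2)
                - ((1 / real (m n)) * (\<Sum>j=1..m n. ?y n (d j)))\<^sup>2) \<le> t})
    \<longlonglongrightarrow> cdf std_normal_distribution t"
  proof (rule studentized_array_clt[OF m_top _ _ _ small])
    show "\<forall>\<^sub>F n in sequentially. \<forall>i\<in>set_pmf (?p n). \<bar>?y n i\<bar> \<le> sqrt (real n)"
      using sd by eventually_elim (auto intro!: abs_zscore_le)
    show "\<forall>\<^sub>F n in sequentially. measure_pmf.expectation (?p n) (?y n) = 0"
      using sd by eventually_elim (simp add: integral_pmf_of_set sum_zscore[simplified])
    show "\<forall>\<^sub>F n in sequentially. measure_pmf.expectation (?p n) (\<lambda>i. (?y n i)\<^sup>2) = 1"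
      using sd by eventually_elim (simp add: integral_pmf_of_set sum_zscore_square[simplified])
  qed
  moreover have "\<forall>\<^sub>F n in sequentially. measure_pmf.prob (iid_sample (m n) (?p n))
      {d. (\<Sum>j=1..m n. ?y n (d j)) / sqrt (real (m n)) /
          sqrt ((1 / real (m n)) * (\<Sum>j=1..m n. (?y n (d j))\<^sup>2)
                - ((1 / real (m n)) * (\<Sum>j=1..m n. ?y n (d j)))\<^sup>2) \<le> t}
    = measure_pmf.prob (multinomial_pmf (m n) (?p n)) {v. boot_T n (m n) (x n) v \<le> t}"
    using sd eventually_compose_filterlim[OF eventually_gt_at_top m_top, of 0]
  proof eventually_elim
    case (elim n)
    let ?T = "\<lambda>d. (\<Sum>j=1..m n. ?y n (d j)) / sqrt (real (m n)) /
          sqrt ((1 / real (m n)) * (\<Sum>j=1..m n. (?y n (d j))\<^sup>2)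
                - ((1 / real (m n)) * (\<Sum>j=1..m n. ?y n (d j)))\<^sup>2)"
    have "?T d = boot_T n (m n) (x n) (draw_counts (m n) d)"
      if "d \<in> set_pmf (iid_sample (m n) (?p n))" for d
    proof (rule boot_T_draw_counts[symmetric])
      show "d ` {1..m n} \<subseteq> {1..n}"
        using set_iid_sample[OF that] elim by auto
    qed (use elim in auto)
    then have "measure_pmf.prob (iid_sample (m n) (?p n)) {d. ?T d \<le> t}
        = measure_pmf.prob (iid_sample (m n) (?p n)) {d. boot_T n (m n) (x n) (draw_counts (m n) d) \<le> t}"
      by (intro measure_pmf.finite_measure_eq_AE AE_pmfI) auto
    also have "\<dots> = measure_pmf.prob (multinomial_pmf (m n) (?p n)) {v. boot_T n (m n) (x n) v \<le> t}"
      by (simp add: multinomial_pmf_def vimage_def)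
    finally show ?case .
  qed
  ultimately show ?thesis by (rule Lim_transform_eventually)
qed

section \<open>Nondegenerate data are almost surely not constant\<close>

text \<open>
  The atom is the point where the distribution function jumps from 0 to 1.
\<close>

lemma (in real_distribution) zero_one_cdf_imp_atom:
  assumes zo: "\<And>x. cdf M x \<in> {0, 1}"
  shows "\<exists>c. prob {c} = 1"
proof -
  define A where "A = {x. cdf M x = 1}"
  have "\<exists>x. 1 / 2 < cdf M x"
    using order_tendstoD(1)[OF cdf_lim_at_top_prob, of "1 / 2"]
    by (auto simp: eventually_at_top_linorder)
  then have "A \<noteq> {}" using zo by (force simp: A_def)
  have "\<exists>l. cdf M l < 1 / 2"
    using order_tendstoD(2)[OF cdf_lim_at_bot, of "1 / 2"]
    by (auto simp: eventually_at_bot_linorder)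
  then obtain l where l: "cdf M l < 1 / 2" by blast
  have "l \<le> x" if "x \<in> A" for x
    using that l cdf_nondecreasing[of x l] by (force simp: A_def)
  then have bdd: "bdd_below A" by (auto simp: bdd_below_def)
  define c where "c = Inf A"
  have above: "cdf M x = 1" if "c < x" for x
  proof -
    have "\<exists>a\<in>A. a < x"
      using cInf_lessD[OF \<open>A \<noteq> {}\<close>, of x] that unfolding c_def by blast
    then obtain a where "a \<in> A" "a < x" by blast
    then have "1 \<le> cdf M x" using cdf_nondecreasing[of a x] by (simp add: A_def)
    then show ?thesis using cdf_bounded_prob[of x] by simp
  qed
  have below: "cdf M x = 0" if "x < c" for x
  proof -
    have "x \<notin> A" using that cInf_lower[OF _ bdd, of x] by (auto simp: c_def)
    then show ?thesis using zo[of x] by (simp add: A_def)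
  qed
  have "(cdf M \<longlongrightarrow> 1) (at_right c)"
    by (rule tendsto_eventually) (auto simp: eventually_at_filter above)
  moreover have "(cdf M \<longlongrightarrow> cdf M c) (at_right c)"
    using cdf_is_right_cont[of c] by (simp add: continuous_within)
  ultimately have "cdf M c = 1"
    using tendsto_unique trivial_limit_at_right_real by blast
  moreover have "(cdf M \<longlongrightarrow> 0) (at_left c)"
    by (rule tendsto_eventually) (auto simp: eventually_at_filter below)
  then have "measure M {..<c} = 0"
    using cdf_at_left[of c] tendsto_unique trivial_limit_at_left_real by blast
  moreover have "measure M {..c} = measure M {..<c} + measure M {c}"
    using finite_measure_Union[of "{..<c}" "{c}"] by (simp add: ivl_disj_un(2)[symmetric] ivl_disj_un)
  ultimately show ?thesis by (auto simp: cdf_def)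
qed

text \<open>
  If the distribution function takes no value strictly between 0 and 1, the variables are almost surely
  equal to a constant, and so are their normalized sums. Then the limiting distribution function
  also takes the values 0 and 1 only, which is impossible for the normal law.
\<close>

lemma DAN_nondegenerate:
  assumes "prob_space P" and DAN: "DAN P X"
    and rv: "\<And>i. i \<ge> 1 \<Longrightarrow> X i \<in> borel_measurable P"
    and id: "\<And>i. i \<ge> 1 \<Longrightarrow> distr P borel (X i) = distr P borel (X 1)"
  shows "\<exists>c. 0 < cdf (distr P borel (X 1)) c \<and> cdf (distr P borel (X 1)) c < 1"
proof (rule ccontr)
  interpret prob_space P by fact
  let ?\<mu> = "distr P borel (X 1)"
  interpret \<mu>: real_distribution ?\<mu> using rv by simp
  assume "\<not> ?thesis"
  then have "cdf ?\<mu> x \<in> {0, 1}" for x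
    using \<mu>.cdf_nonneg[of x] \<mu>.cdf_bounded_prob[of x] by (auto simp: less_le)
  then obtain c where "measure ?\<mu> {c} = 1" using \<mu>.zero_one_cdf_imp_atom by blast
  then have c: "AE x in ?\<mu>. x = c"
    using \<mu>.prob_eq_1[of "{c}"] by simp
  have "AE \<omega> in P. X i \<omega> = c" if "i \<ge> 1" for i
    using c AE_distrD[OF rv[OF that]] unfolding id[OF that, symmetric] by blast
  then have all: "AE \<omega> in P. \<forall>i\<in>{1..}. X i \<omega> = c"
    by (subst AE_ball_countable) auto
  obtain a b where conv: "weak_conv_m (\<lambda>n. distr P borel (\<lambda>\<omega>. ((\<Sum>i=1..n. X i \<omega>) - a n) / b n))
      std_normal_distribution"
    using DAN by (auto simp: DAN_def)
  interpret sn: real_distribution std_normal_distribution by (rule real_dist_normal_dist)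
  have "cdf std_normal_distribution x \<in> {0, 1}" for x
  proof -
    have zo: "cdf (distr P borel (\<lambda>\<omega>. ((\<Sum>i=1..n. X i \<omega>) - a n) / b n)) x \<in> {0, 1}" for n
    proof -
      have meas: "(\<lambda>\<omega>. ((\<Sum>i=1..n. X i \<omega>) - a n) / b n) \<in> borel_measurable P"
        using rv by (intro borel_measurable_divide borel_measurable_diff borel_measurable_sum
            borel_measurable_const) auto
      have "cdf (distr P borel (\<lambda>\<omega>. ((\<Sum>i=1..n. X i \<omega>) - a n) / b n)) x
          = prob {\<omega> \<in> space P. ((\<Sum>i=1..n. X i \<omega>) - a n) / b n \<le> x}"
        unfolding cdf_def measure_distr[OF meas atMost_borel]
        by (auto intro!: arg_cong[where f = prob])
      also have "\<dots> = prob {\<omega> \<in> space P. (real n * c - a n) / b n \<le> x}"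
      proof (intro finite_measure_eq_AE borel_measurable_le[OF meas] borel_measurable_const)
        show "AE \<omega> in P. \<omega> \<in> {\<omega> \<in> space P. ((\<Sum>i=1..n. X i \<omega>) - a n) / b n \<le> x} \<longleftrightarrow>
            \<omega> \<in> {\<omega> \<in> space P. (real n * c - a n) / b n \<le> x}"
          using all by eventually_elim simp
      qed simp
      also have "\<dots> \<in> {0, 1}"
        by (cases "(real n * c - a n) / b n \<le> x") (simp_all add: prob_space)
      finally show ?thesis .
    qed
    have "(\<lambda>n. cdf (distr P borel (\<lambda>\<omega>. ((\<Sum>i=1..n. X i \<omega>) - a n) / b n)) x)
        \<longlonglongrightarrow> cdf std_normal_distribution x"
      using conv isCont_cdf_std_normal unfolding weak_conv_m_def weak_conv_def by blast
    from closed_sequentially[OF finite_imp_closed zo this] show ?thesis by simp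
  qed
  then obtain d where "measure std_normal_distribution {d} = 1"
    using sn.zero_one_cdf_imp_atom by blast
  then show False
    using isCont_cdf_std_normal[of d] by (simp add: sn.isCont_cdf)
qed

text \<open>
  If all variables are equal, then the first \<open>n\<close> of them are all at most \<open>c\<close> or all greater than \<open>c\<close>. With
  \<open>q = P(X 1 \<le> c)\<close>, this has probability \<open>q\<^sup>n + (1 - q)\<^sup>n\<close>, which tends to 0.
\<close>

lemma (in prob_space) AE_iid_nonconstant:
  fixes X :: "nat \<Rightarrow> 'a \<Rightarrow> real"
  assumes ind: "indep_vars (\<lambda>_. borel) X {1..}"
    and id: "\<And>i. i \<ge> 1 \<Longrightarrow> distr M borel (X i) = distr M borel (X 1)"
    and c: "0 < cdf (distr M borel (X 1)) c" "cdf (distr M borel (X 1)) c < 1"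
  shows "AE \<omega> in M. \<exists>i\<ge>1. X i \<omega> \<noteq> X 1 \<omega>"
proof -
  let ?q = "cdf (distr M borel (X 1)) c"
  have rv: "random_variable borel (X i)" if "i \<ge> 1" for i
    using ind that by (simp add: indep_vars_def)
  interpret \<mu>: real_distribution "distr M borel (X 1)" using rv by simp
  have P: "prob (X i -` B \<inter> space M) = measure (distr M borel (X 1)) B"
    if "i \<ge> 1" "B \<in> sets borel" for i B
    unfolding id[OF that(1), symmetric] using that rv by (simp add: measure_distr)
  define E where "E = {\<omega> \<in> space M. \<forall>i. X (Suc i) \<omega> = X 1 \<omega>}"
  have E: "E \<in> events"
    unfolding E_def using rv by (intro sets.sets_Collect_countable_All borel_measurable_eq) auto
  have E_iff: "\<omega> \<in> E \<longleftrightarrow> \<omega> \<in> space M \<and> (\<forall>i\<ge>1. X i \<omega> = X 1 \<omega>)" for \<omega>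
    unfolding E_def by (auto dest!: Suc_le_D)
  have inter: "prob (\<Inter>i\<in>{1..n}. X i -` B \<inter> space M) = measure (distr M borel (X 1)) B ^ n"
    if "1 \<le> n" "B \<in> sets borel" for n B
    using indep_varsD[OF ind, of "{1..n}" "\<lambda>_. B"] that P by simp
  have bound: "prob E \<le> ?q ^ n + (1 - ?q) ^ n" if "1 \<le> n" for n
  proof -
    let ?L = "\<Inter>i\<in>{1..n}. X i -` {..c} \<inter> space M" and ?U = "\<Inter>i\<in>{1..n}. X i -` {c<..} \<inter> space M"
    have LU: "?L \<in> events" "?U \<in> events"
      using rv that by (auto intro!: sets.finite_INT measurable_sets)
    have "E \<subseteq> ?L \<union> ?U"
    proof
      fix \<omega> assume "\<omega> \<in> E"
      then have \<omega>: "\<omega> \<in> space M" and eq: "\<And>i. i \<ge> 1 \<Longrightarrow> X 1 \<omega> = X i \<omega>"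
        unfolding E_iff by metis+
      show "\<omega> \<in> ?L \<union> ?U"
      proof (cases "X 1 \<omega> \<le> c")
        case True
        then have "X i \<omega> \<le> c" if "i \<in> {1..n}" for i using eq[of i] that by simp
        then show ?thesis using \<omega> by simp
      next
        case False
        then have "c < X i \<omega>" if "i \<in> {1..n}" for i using eq[of i] that by simp
        then show ?thesis using \<omega> by simp
      qed
    qed
    then have "prob E \<le> prob ?L + prob ?U"
      using LU by (intro order_trans[OF finite_measure_mono measure_Un_le]) auto
    also have "prob ?L = ?q ^ n" using inter[OF that, of "{..c}"] by (simp add: cdf_def)
    also have "prob ?U = (1 - ?q) ^ n"
      using inter[OF that, of "{c<..}"] \<mu>.prob_compl[of "{..c}"]
      by (simp add: cdf_def Compl_eq_Diff_UNIV[symmetric])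
    finally show ?thesis .
  qed
  have "(\<lambda>n. ?q ^ n + (1 - ?q) ^ n) \<longlonglongrightarrow> 0 + 0"
    using c by (intro tendsto_add LIMSEQ_realpow_zero) auto
  then have "prob E \<le> 0 + 0"
    by (rule LIMSEQ_le_const) (use bound in blast)
  then have "prob E = 0" using measure_nonneg[of M E] by linarith
  then have "AE \<omega> in M. \<omega> \<notin> E" using E prob_eq_0 by blast
  then show ?thesis
    by (rule AE_mp) (auto simp: E_iff)
qed

section \<open>Conditional probabilities given the data\<close>

text \<open>
  The target carries the full power set as \<open>\<sigma>\<close>-algebra, although the space of all functions is
  uncountable when the index type is infinite. The map is measurable because its values are
  supported in the finite set \<open>I\<close>, so that there are only countably many of them.
\<close>

lemma measurable_padded_counts:
  fixes w :: "'i \<Rightarrow> 'b \<Rightarrow> nat"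
  assumes I: "finite I" and w: "\<And>i. i \<in> I \<Longrightarrow> w i \<in> measurable Q (count_space UNIV)"
  shows "(\<lambda>\<omega> i. if i \<in> I then w i \<omega> else 0) \<in> measurable Q (count_space UNIV)"
proof -
  let ?f = "\<lambda>\<omega> i. if i \<in> I then w i \<omega> else 0"
  define A where "A = (\<lambda>g i. if i \<in> I then g i else 0) ` (PiE I (\<lambda>_. UNIV :: nat set))"
  have "countable A"
    unfolding A_def using I by (intro countable_image countable_PiE) auto
  have "?f \<omega> \<in> A" for \<omega>
    unfolding A_def by (rule image_eqI[of _ _ "restrict (\<lambda>i. w i \<omega>) I"]) auto
  moreover have "?f -` {a} \<inter> space Q \<in> sets Q" if "a \<in> A" for a
  proof -
    have "?f -` {a} \<inter> space Q = {\<omega> \<in> space Q. \<forall>i\<in>I. w i \<omega> = a i}"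
      using that unfolding A_def fun_eq_iff by (auto split: if_splits) (metis (full_types))+
    also have "\<dots> \<in> sets Q"
    proof (rule sets.sets_Collect_finite_All[OF _ I])
      fix i assume "i \<in> I"
      from measurable_sets[OF w[OF this], of "{a i}"] show "{\<omega> \<in> space Q. w i \<omega> = a i} \<in> sets Q"
        by (simp add: vimage_def Int_def conj_commute)
    qed
    finally show ?thesis .
  qed
  ultimately have "?f \<in> measurable Q (count_space A)"
    using \<open>countable A\<close> by (simp add: measurable_count_space_eq_countable)
  then show ?thesis
    by (rule measurable_compose[where g = "\<lambda>a. a"]) simp
qed

text \<open>
  Conditioning on the data when the second coordinate is independent of them: the conditional probability
  of an event is the \<open>Q\<close>-measure of its section at the observed data. This section probability is a
  function of the data, and Fubini's theorem shows that it has the right integrals over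
  the events of \<open>data_algebra\<close>.
\<close>

lemma data_cond_prob_eq_section:
  fixes P :: "'a measure" and Q :: "'b measure" and X :: "nat \<Rightarrow> 'a \<Rightarrow> real"
  assumes "prob_space P" "prob_space Q"
    and X: "\<And>i. i \<in> {1..n} \<Longrightarrow> X i \<in> borel_measurable P"
    and S: "S \<in> sets ((\<Pi>\<^sub>M i\<in>{1..n}. borel) \<Otimes>\<^sub>M Q)"
    and A: "A = {(x, y) \<in> space (P \<Otimes>\<^sub>M Q). (\<lambda>i\<in>{1..n}. X i x, y) \<in> S}"
  shows "AE x in P. data_cond_prob P Q X n A x = measure Q (Pair (\<lambda>i\<in>{1..n}. X i x) -` S)"
proof -
  interpret P: prob_space P by fact
  interpret Q: prob_space Q by fact
  interpret PQ: pair_prob_space P Q ..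
  let ?R = "\<Pi>\<^sub>M i\<in>{1..n}. borel :: real measure"
  let ?N = "P \<Otimes>\<^sub>M Q" and ?F = "data_algebra P Q X n"
  define h where "h x = (\<lambda>i\<in>{1..n}. X i x)" for x
  define G where "G z = measure Q (Pair z -` S)" for z
  have h [measurable]: "h \<in> measurable P ?R"
    unfolding h_def using X by (intro measurable_restrict) auto
  have G [measurable]: "G \<in> borel_measurable ?R"
    unfolding G_def measure_def using Q.measurable_emeasure_Pair[OF S] by measurable
  have S' [measurable]: "S \<in> sets (?R \<Otimes>\<^sub>M Q)" by (fact S)
  have AN: "A = (\<lambda>(x, y). (h x, y)) -` S \<inter> space ?N"
    by (auto simp: A h_def)
  have A_sets [measurable]: "A \<in> sets ?N"
    unfolding AN by (rule measurable_sets[OF _ S]) measurable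
  have F_space: "space ?F = space ?N"
    by (simp add: data_algebra_def)
  have hF: "(\<lambda>(x, y). h x) \<in> measurable ?F ?R"
    unfolding data_algebra_def h_def by (rule measurable_vimage_algebra1) (auto simp: space_PiM)
  have F_sets: "sets ?F = {(\<lambda>(x, y). h x) -` C \<inter> space ?N |C. C \<in> sets ?R}"
    unfolding data_algebra_def h_def by (rule sets_vimage_algebra2) (auto simp: space_PiM)
  have hN: "(\<lambda>(x, y). h x) \<in> measurable ?N ?R"
    by measurable
  have sub: "subalgebra ?N ?F"
    unfolding subalgebra_def F_space F_sets using measurable_sets[OF hN] by blast
  interpret F: finite_measure_subalgebra ?N ?F
    by unfold_locales (rule sub)
  have G_le: "\<bar>G z\<bar> \<le> 1" for z by (simp add: G_def)
  have "AE u in ?N. real_cond_exp ?N ?F (indicator A) u = (case u of (x, y) \<Rightarrow> G (h x))"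
  proof (rule F.real_cond_exp_charact)
    show "integrable ?N (indicator A :: _ \<Rightarrow> real)"
      by (rule PQ.integrable_const_bound[of _ 1]) (auto simp: indicator_def)
    show "integrable ?N (\<lambda>(x, y). G (h x))"
      by (rule PQ.integrable_const_bound[of _ 1]) (use G_le in auto)
    show "(\<lambda>(x, y). G (h x)) \<in> borel_measurable ?F"
      using measurable_compose[OF hF G] by (simp add: case_prod_beta')
    fix B assume "B \<in> sets ?F"
    then obtain C where C [measurable]: "C \<in> sets ?R" and B: "B = (\<lambda>(x, y). h x) -` C \<inter> space ?N"
      unfolding F_sets by blast
    have [measurable]: "B \<in> sets ?N" unfolding B by measurable
    have "(\<integral>u\<in>B. (indicator A u :: real) \<partial>?N) = (\<integral>u. indicator C (h (fst u)) * indicator A u \<partial>?N)"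
      unfolding set_lebesgue_integral_def
      by (rule Bochner_Integration.integral_cong) (auto simp: B indicator_def)
    also have "\<dots> = (\<integral>x. (\<integral>y. indicator C (h x) * indicator A (x, y) \<partial>Q) \<partial>P)"
      by (subst PQ.integral_fst'[symmetric])
        (auto intro!: PQ.integrable_const_bound[of _ 1] simp: indicator_def)
    also have "\<dots> = (\<integral>x. indicator C (h x) * G (h x) \<partial>P)"
    proof (rule Bochner_Integration.integral_cong[OF refl])
      fix x assume x: "x \<in> space P"
      have sec: "Pair (h x) -` S \<in> sets Q" using sets_Pair1[OF S] .
      have "(\<integral>y. (indicator C (h x) * indicator A (x, y) :: real) \<partial>Q)
          = indicator C (h x) * (\<integral>y. indicator (Pair (h x) -` S) y \<partial>Q)"
        unfolding integral_mult_right_zero[symmetric]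
        by (rule Bochner_Integration.integral_cong)
          (auto simp: AN indicator_def space_pair_measure x)
      then show "(\<integral>y. (indicator C (h x) * indicator A (x, y) :: real) \<partial>Q) = indicator C (h x) * G (h x)"
        using sec by (simp add: G_def)
    qed
    also have "\<dots> = (\<integral>x. (\<integral>y. indicator C (h x) * G (h x) \<partial>Q) \<partial>P)"
      by (simp add: Q.prob_space)
    also have "\<dots> = (\<integral>u. indicator C (h (fst u)) * G (h (fst u)) \<partial>?N)"
      by (subst PQ.integral_fst'[symmetric])
        (use G_le in \<open>auto intro!: PQ.integrable_const_bound[of _ 1] simp: indicator_def\<close>)
    also have "\<dots> = (\<integral>u\<in>B. (case u of (x, y) \<Rightarrow> G (h x)) \<partial>?N)"
      unfolding set_lebesgue_integral_def
      by (rule Bochner_Integration.integral_cong) (auto simp: B indicator_def)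
    finally show "(\<integral>u\<in>B. indicator A u \<partial>?N) = (\<integral>u\<in>B. (case u of (x, y) \<Rightarrow> G (h x)) \<partial>?N)" .
  qed
  \<comment> \<open>Neither side of the equation in question depends on \<open>y\<close>, so the point chosen in \<open>data_cond_prob\<close> is as good as any.\<close>
  then have "AE x in P. AE y in Q. joint_cond_prob P Q X n A (x, y) = G (h x)"
    unfolding joint_cond_prob_def[symmetric] by (auto dest: PQ.AE_pair)
  then show ?thesis
  proof (rule AE_mp[OF _ AE_I2], intro impI)
    fix x assume x: "x \<in> space P" and "AE y in Q. joint_cond_prob P Q X n A (x, y) = G (h x)"
    then have "AE y in Q. data_cond_prob P Q X n A x = G (h x)"
      by (elim AE_mp) (auto simp: joint_cond_prob_eq)
    then show "data_cond_prob P Q X n A x = measure Q (Pair (\<lambda>i\<in>{1..n}. X i x) -` S)"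
      by (simp add: G_def h_def)
  qed
qed

lemma boot_T_cong:
  assumes "\<And>i. i \<in> {1..n} \<Longrightarrow> x i = x' i" "\<And>i. i \<in> {1..n} \<Longrightarrow> v i = v' i"
  shows "boot_T n m x v = boot_T n m x' v'"
proof -
  have "boot_mean n m x v = boot_mean n m x' v'"
    unfolding boot_mean_def using assms by (auto intro!: sum.cong)
  then show ?thesis
    unfolding boot_T_def boot_var_def using assms by (auto intro!: arg_cong2[where f = "(/)"] sum.cong)
qed

lemma borel_measurable_boot_T:
  fixes f :: "'c \<Rightarrow> nat \<Rightarrow> real" and v :: "'c \<Rightarrow> nat \<Rightarrow> nat"
  assumes f: "\<And>i. i \<in> {1..n} \<Longrightarrow> (\<lambda>u. f u i) \<in> borel_measurable M"
    and v: "\<And>i. i \<in> {1..n} \<Longrightarrow> (\<lambda>u. v u i) \<in> measurable M (count_space UNIV)"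
  shows "(\<lambda>u. boot_T n m (f u) (v u)) \<in> borel_measurable M"
proof -
  have v': "(\<lambda>u. real (v u i)) \<in> borel_measurable M" if "i \<in> {1..n}" for i
    using v[OF that] by (rule measurable_compose) simp
  show ?thesis
    unfolding boot_T_def boot_var_def boot_mean_def
    by (intro borel_measurable_divide borel_measurable_times borel_measurable_diff
        borel_measurable_sum borel_measurable_power borel_measurable_const f v'
        measurable_compose[OF _ borel_measurable_sqrt]) assumption+
qed

text \<open>
  Only the row \<open>n\<close> of the weights enters \<open>T_event\<close>, and its law is multinomial; so the section
  probabilities are multinomial probabilities.
\<close>

lemma data_cond_prob_T_event:
  fixes P :: "'a measure" and Q :: "'b measure"
  assumes PQ: "prob_space P" "prob_space Q"
    and X: "\<And>i. i \<in> {1..n} \<Longrightarrow> X i \<in> borel_measurable P"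
    and w: "efron_weights Q m w" and n: "1 \<le> n"
  shows "AE x in P. data_cond_prob P Q X n (T_event P Q X m w n t) x
    = measure_pmf.prob (multinomial_pmf (m n) (pmf_of_set {1..n}))
        {v. boot_T n (m n) (\<lambda>i. X i x) v \<le> t}"
proof -
  let ?R = "\<Pi>\<^sub>M i\<in>{1..n}. borel :: real measure"
  let ?W = "\<lambda>y i. if i \<in> {1..n} then w n i y else 0"
  define S where "S = {u \<in> space (?R \<Otimes>\<^sub>M Q). boot_T n (m n) (fst u) (\<lambda>i. w n i (snd u)) \<le> t}"
  have wm: "w n i \<in> measurable Q (count_space UNIV)" if "i \<in> {1..n}" for i
    using w n that by (auto simp: efron_weights_def)
  have S: "S \<in> sets (?R \<Otimes>\<^sub>M Q)"
    unfolding S_def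
  proof (intro borel_measurable_le borel_measurable_boot_T borel_measurable_const)
    fix i assume i: "i \<in> {1..n}"
    show "(\<lambda>u. fst u i) \<in> borel_measurable (?R \<Otimes>\<^sub>M Q)"
      using measurable_compose[OF measurable_fst measurable_component_singleton[OF i]] .
    show "(\<lambda>u. w n i (snd u)) \<in> measurable (?R \<Otimes>\<^sub>M Q) (count_space UNIV)"
      using measurable_compose[OF measurable_snd wm[OF i]] .
  qed
  have T: "boot_T n (m n) (\<lambda>i\<in>{1..n}. X i x) (\<lambda>i. w n i y) = boot_T n (m n) (\<lambda>i. X i x) (?W y)"
    and T': "boot_T n (m n) (\<lambda>i. X i x) (\<lambda>i. w n i y) = boot_T n (m n) (\<lambda>i. X i x) (?W y)" for x y
    by (rule boot_T_cong; simp)+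
  have ev: "T_event P Q X m w n t
      = {(x, y) \<in> space (P \<Otimes>\<^sub>M Q). (\<lambda>i\<in>{1..n}. X i x, y) \<in> S}"
    unfolding T_event_def S_def by (auto simp: space_pair_measure space_PiM T[simplified] T'[simplified])
  have "measure Q (Pair (\<lambda>i\<in>{1..n}. X i x) -` S)
      = measure_pmf.prob (multinomial_pmf (m n) (pmf_of_set {1..n}))
        {v. boot_T n (m n) (\<lambda>i. X i x) v \<le> t}" for x
  proof -
    have "Pair (\<lambda>i\<in>{1..n}. X i x) -` S
        = ?W -` {v. boot_T n (m n) (\<lambda>i. X i x) v \<le> t} \<inter> space Q"
      unfolding S_def by (auto simp: space_pair_measure space_PiM T[simplified])
    then have "measure Q (Pair (\<lambda>i\<in>{1..n}. X i x) -` S)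
        = measure (distr Q (count_space UNIV) ?W) {v. boot_T n (m n) (\<lambda>i. X i x) v \<le> t}"
      using measurable_padded_counts[of "{1..n}" "w n" Q] wm by (simp add: measure_distr)
    then show ?thesis using w n by (simp add: efron_weights_def)
  qed
  then show ?thesis
    using data_cond_prob_eq_section[OF PQ X S ev] by simp
qed

lemma borel_measurable_data_cond_prob:
  assumes "prob_space Q"
  shows "data_cond_prob P Q X n A \<in> borel_measurable P"
proof -
  interpret Q: prob_space Q by fact
  have "(SOME y. y \<in> space Q) \<in> space Q"
    using Q.not_empty by (simp add: some_in_eq)
  then have "(\<lambda>x. (x, SOME y. y \<in> space Q)) \<in> measurable P (P \<Otimes>\<^sub>M Q)"
    by (rule measurable_Pair2')
  moreover have "joint_cond_prob P Q X n A \<in> borel_measurable (P \<Otimes>\<^sub>M Q)"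
    unfolding joint_cond_prob_def by simp
  ultimately show ?thesis
    unfolding data_cond_prob_def by (rule measurable_compose)
qed

text \<open>
  Dominated convergence for the indicators of the events of deviation.
\<close>

lemma AE_tendsto_imp_conv_in_prob:
  fixes f :: "nat \<Rightarrow> 'a \<Rightarrow> real"
  assumes "prob_space P" and f [measurable]: "\<And>n. f n \<in> borel_measurable P"
    and lim: "AE \<omega> in P. (\<lambda>n. f n \<omega>) \<longlonglongrightarrow> c"
  shows "conv_in_prob P f c"
  unfolding conv_in_prob_def
proof (intro allI impI)
  fix \<epsilon> :: real assume "0 < \<epsilon>"
  interpret prob_space P by fact
  let ?B = "\<lambda>n. {\<omega> \<in> space P. \<bar>f n \<omega> - c\<bar> > \<epsilon>}"
  have "(\<lambda>n. \<integral>\<omega>. indicator (?B n) \<omega> \<partial>P) \<longlonglongrightarrow> (\<integral>\<omega>. (0 :: real) \<partial>P)"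
  proof (rule integral_dominated_convergence[where w = "\<lambda>_. 1"])
    show "AE \<omega> in P. (\<lambda>n. indicator (?B n) \<omega> :: real) \<longlonglongrightarrow> 0"
      using lim
    proof eventually_elim
      case (elim \<omega>)
      have "\<forall>\<^sub>F n in sequentially. indicator (?B n) \<omega> = (0 :: real)"
        using tendstoD[OF elim \<open>0 < \<epsilon>\<close>] by eventually_elim (simp add: dist_real_def)
      then show ?case by (rule tendsto_eventually)
    qed
  qed (auto simp: indicator_def)
  then show "(\<lambda>n. prob (?B n)) \<longlonglongrightarrow> 0" by simp
qed

text \<open>
  Almost every \<open>\<omega>\<close> yields a nonconstant sequence of data, and for such data
  \<open>multinomial_boot_clt\<close> applies. As there are countably many sample sizes, the null sets on which
  the conditional probabilities differ from the multinomial ones have a null union.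
\<close>

theorem AE_conditional_boot_clt:
  fixes P :: "'a measure" and Q :: "'b measure"
    and X :: "nat \<Rightarrow> 'a \<Rightarrow> real" and m :: "nat \<Rightarrow> nat" and w :: "nat \<Rightarrow> nat \<Rightarrow> 'b \<Rightarrow> nat"
  assumes PQ: "prob_space P" "prob_space Q"
    and ind: "prob_space.indep_vars P (\<lambda>_. borel) X {1..}"
    and id: "\<And>i. i \<ge> 1 \<Longrightarrow> distr P borel (X i) = distr P borel (X 1)"
    and DAN: "DAN P X"
    and w: "efron_weights Q m w"
    and m: "filterlim (\<lambda>n. real (m n) / real n) at_top sequentially"
  shows "AE \<omega> in P. (\<lambda>n. data_cond_prob P Q X n (T_event P Q X m w n t) \<omega>)
    \<longlonglongrightarrow> cdf std_normal_distribution t"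
proof -
  interpret P: prob_space P by (rule PQ)
  have rv: "X i \<in> borel_measurable P" if "i \<ge> 1" for i
    using ind that by (simp add: P.indep_vars_def)
  obtain c where c: "0 < cdf (distr P borel (X 1)) c" "cdf (distr P borel (X 1)) c < 1"
    using DAN_nondegenerate[OF PQ(1) DAN rv id] by blast
  have "AE \<omega> in P. \<exists>i\<ge>1. X i \<omega> \<noteq> X 1 \<omega>"
    by (rule P.AE_iid_nonconstant[OF ind id c])
  moreover have "AE \<omega> in P. \<forall>n\<in>{1..}. data_cond_prob P Q X n (T_event P Q X m w n t) \<omega>
      = measure_pmf.prob (multinomial_pmf (m n) (pmf_of_set {1..n}))
        {v. boot_T n (m n) (\<lambda>i. X i \<omega>) v \<le> t}"
    using data_cond_prob_T_event[OF PQ rv w] by (subst AE_ball_countable) auto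
  ultimately show ?thesis
  proof eventually_elim
    case (elim \<omega>)
    then obtain i where i: "i \<ge> 1" "X i \<omega> \<noteq> X 1 \<omega>" by blast
    have "\<forall>\<^sub>F n in sequentially. \<exists>i\<in>{1..n}. X i \<omega> \<noteq> X 1 \<omega>"
      using eventually_ge_at_top[of i] by eventually_elim (use i in auto)
    then have "(\<lambda>n. measure_pmf.prob (multinomial_pmf (m n) (pmf_of_set {1..n}))
        {v. boot_T n (m n) (\<lambda>i. X i \<omega>) v \<le> t}) \<longlonglongrightarrow> cdf std_normal_distribution t"
      by (rule multinomial_boot_clt[OF m])
    moreover have "\<forall>\<^sub>F n in sequentially. measure_pmf.prob (multinomial_pmf (m n) (pmf_of_set {1..n}))
        {v. boot_T n (m n) (\<lambda>i. X i \<omega>) v \<le> t}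
        = data_cond_prob P Q X n (T_event P Q X m w n t) \<omega>"
      using eventually_ge_at_top[of 1] by eventually_elim (use elim in auto)
    ultimately show ?case by (rule Lim_transform_eventually)
  qed
qed

lemma filterlim_ratio_of_nlogn:
  assumes "filterlim (\<lambda>n. real (m n) / (2 * real n * ln (real n))) at_top sequentially"
  shows "filterlim (\<lambda>n. real (m n) / real n) at_top sequentially"
proof (rule filterlim_at_top_mono[OF assms])
  show "\<forall>\<^sub>F n in sequentially. real (m n) / (2 * real n * ln (real n)) \<le> real (m n) / real n"
    using eventually_ge_at_top[of "3 :: nat"]
  proof eventually_elim
    case (elim n)
    \<comment> \<open>For \<open>n \<ge> 3\<close>, since \<open>e \<le> 3\<close>.\<close>
    have "1 \<le> ln (real n)"
      using elim exp_le by (subst ln_ge_iff) auto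
    then have "real n * 1 \<le> real n * (2 * ln (real n))" by (intro mult_left_mono) auto
    then show ?case using elim by (intro divide_left_mono) auto
  qed
qed

theorem theorem3p1:
  fixes P :: "'a measure" and Q :: "'b measure"
    and X :: "nat \<Rightarrow> 'a \<Rightarrow> real" and m :: "nat \<Rightarrow> nat" and w :: "nat \<Rightarrow> nat \<Rightarrow> 'b \<Rightarrow> nat"
  assumes "prob_space P" and "prob_space Q"
    and "prob_space.indep_vars P (\<lambda>_. borel) X {1..}"
    and "\<And>i. i \<ge> 1 \<Longrightarrow> distr P borel (X i) = distr P borel (X 1)"
    and "DAN P X"
    and "efron_weights Q m w"
    and "filterlim m at_top sequentially"
  shows
    "(filterlim (\<lambda>n. real (m n) / (2 * real n * ln (real n))) at_top sequentially \<longrightarrow>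
        (\<forall>t. conv_in_prob P (\<lambda>n. data_cond_prob P Q X n (T_event P Q X m w n t))
               (cdf std_normal_distribution t)) \<and>
        (integrable P (\<lambda>\<omega>. (X 1 \<omega>)\<^sup>2) \<longrightarrow>
          (\<forall>t. AE \<omega> in P. (\<lambda>n. data_cond_prob P Q X n (T_event P Q X m w n t) \<omega>)
                 \<longlonglongrightarrow> cdf std_normal_distribution t)))
     \<and>
     (filterlim (\<lambda>n. real (m n) / real n) at_top sequentially \<longrightarrow>
        integrable P (\<lambda>\<omega>. (X 1 \<omega>)\<^sup>2) \<longrightarrow>
          (\<forall>t. conv_in_prob P (\<lambda>n. data_cond_prob P Q X n (T_event P Q X m w n t))
                 (cdf std_normal_distribution t)))"
proof -
  have as: "AE \<omega> in P. (\<lambda>n. data_cond_prob P Q X n (T_event P Q X m w n t) \<omega>)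
      \<longlonglongrightarrow> cdf std_normal_distribution t"
    if "filterlim (\<lambda>n. real (m n) / real n) at_top sequentially" for t
    by (rule AE_conditional_boot_clt[OF assms(1-6) that])
  have pr: "conv_in_prob P (\<lambda>n. data_cond_prob P Q X n (T_event P Q X m w n t))
      (cdf std_normal_distribution t)"
    if "filterlim (\<lambda>n. real (m n) / real n) at_top sequentially" for t
    by (rule AE_tendsto_imp_conv_in_prob[OF assms(1) borel_measurable_data_cond_prob[OF assms(2)] as[OF that]])
  show ?thesis
    using as pr filterlim_ratio_of_nlogn[of m] by blast
qed

end
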